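(* Let $b, c$ be integers satisfying $-3 \le b \le 0$ and $c \le -b-3$. Then $\mathbb{Q}(\alpha) \neq \mathbb{Q}(\beta)$ holds for all $\alpha, \beta \in I_{b,c}^{3,tr}$ with $\alpha \neq \beta$. Moreover, let $\delta_b, \epsilon_b$ ($b \in \{0,-1,-2,-3\}$) be the integers defined by $\delta_0 = \delta_{-1} = 1$, $\delta_{-2} = \delta_{-3} = 0$, $\epsilon_0 = 1$, $\epsilon_{-1} = \epsilon_{-2} = \epsilon_{-3} = 0$. Then all the elements of $I_{b,c}^{3,tr}$ are totally real cubic if $c$ is of the form $-n^2+(b-1)n-1$ with $n \in \mathbb{Z}$, $n \ge \delta_b$, or of the form $-n^2+bn$ with $n \in \mathbb{Z}$, $n \ge 1+\epsilon_b-\epsilon_{-3-b}$. Otherwise all the elements of $I_{b,c}^{3,tr}$, except exactly one, are totally real cubic, and the exceptional element is real quadratic. Specifically, for $c$ satisfying $-n^2+(b-1)n-1 < c < -n^2+bn$ with $n \in \mathbb{Z}$, $n \ge 1+\epsilon_b$, the unique quadratic element is a root of the polynomial $x^3+bx^2+cx-(n-b)(c+n^2-bn)$, and its minimal polynomial over $\mathbb{Q}$ is $x^2+nx+c+n^2-bn$. The same is true (with the same polynomials) for $c$ satisfying $-n^2+bn < c < -n^2+(b-1)n-1$ with $n \in \mathbb{Z}$, $n \le -3-\epsilon_{-3-b}$.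
   Context: For integers $m, n$ satisfying $n \le -m-3$, define $$I_{m,n}^{3,tr} := \{\alpha \in (0,1) \mid \alpha^3+m\alpha^2+n\alpha+d=0 \text{ for some } d \in \mathbb{Z},\ 1 \le d \le -m-n-2\}.$$ An algebraic number is totally real cubic if it has degree three over $\mathbb{Q}$ and all its conjugates are real; it is real quadratic if it is real and has degree two over $\mathbb{Q}$. $\mathbb{Q}(\alpha)$ denotes the subfield of $\mathbb{C}$ generated by $\alpha$. *)

theory Defs
  imports Complex_Main "HOL-Computational_Algebra.Computational_Algebra"
begin

definition is_subfield :: "complex set \<Rightarrow> bool" where
  "is_subfield K \<longleftrightarrow> 0 \<in> K \<and> 1 \<in> K \<and>
     (\<forall>x\<in>K. \<forall>y\<in>K. x + y \<in> K \<and> x * y \<in> K) \<and>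
     (\<forall>x\<in>K. - x \<in> K \<and> inverse x \<in> K)"

definition rat_adjoin :: "complex \<Rightarrow> complex set" where
  "rat_adjoin z = is_subfield hull {z}"

lemma is_subfield_rat_adjoin: "is_subfield (rat_adjoin z)"
  unfolding rat_adjoin_def by (rule hull_in) (auto simp: is_subfield_def)

lemma poly_of_rat_mult:
  "poly (map_poly of_rat (p * q)) (z :: complex) =
     poly (map_poly of_rat p) z * poly (map_poly of_rat q) z"
proof -
  have "map_poly of_rat (p * q) = map_poly of_rat p * (map_poly of_rat q :: complex poly)"
    by (rule poly_eqI) (simp add: coeff_map_poly coeff_mult of_rat_sum of_rat_mult)
  then show ?thesis by simp
qed

lemma poly_of_rat_add:
  "poly (map_poly of_rat (p + q)) (z :: complex) =
     poly (map_poly of_rat p) z + poly (map_poly of_rat q) z"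
proof -
  have "map_poly of_rat (p + q) = map_poly of_rat p + (map_poly of_rat q :: complex poly)"
    by (rule poly_eqI) (simp add: coeff_map_poly of_rat_add)
  then show ?thesis by simp
qed

text \<open>
  The minimal polynomial over the rationals; the description is only meaningful for
  algebraic numbers, for which \<open>ex1_rat_min_poly\<close> below shows that it is well defined.
\<close>
definition rat_min_poly :: "complex \<Rightarrow> rat poly" where
  "rat_min_poly z =
     (THE p. lead_coeff p = 1 \<and> irreducible p \<and> poly (map_poly of_rat p) z = 0)"

lemma ex1_rat_min_poly:
  assumes "algebraic (z :: complex)"
  shows "\<exists>!p. lead_coeff p = (1 :: rat) \<and> irreducible p \<and> poly (map_poly of_rat p) z = 0"
proof -
  obtain r :: "int poly" where r: "r \<noteq> 0" "poly (map_poly of_int r) z = 0"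
    using assms by (elim algebraicE') auto
  define r' where "r' = map_poly rat_of_int r"
  have "r' \<noteq> 0" "poly (map_poly of_rat r') z = 0"
    using r by (auto simp: r'_def map_poly_map_poly o_def map_poly_eq_0_iff)
  then have ex: "\<exists>q :: rat poly. q \<noteq> 0 \<and> poly (map_poly of_rat q) z = 0" by blast
  define P where "P q \<longleftrightarrow> q \<noteq> 0 \<and> poly (map_poly of_rat q) z = 0" for q :: "rat poly"
  obtain q where q: "P q" and least: "\<And>s. P s \<Longrightarrow> degree q \<le> degree s"
    using ex ex_has_least_nat[of P _ degree] unfolding P_def by blast
  define p where "p = smult (inverse (lead_coeff q)) q"
  have mono: "lead_coeff p = 1" and "p \<noteq> 0" and deg: "degree p = degree q"
    using q by (auto simp: p_def P_def)
  have root: "poly (map_poly of_rat p) z = 0"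
    using q poly_of_rat_mult[of "[:inverse (lead_coeff q):]" q z] by (simp add: p_def P_def)
  have "irreducible p"
  proof (rule irreducibleI)
    show "p \<noteq> 0" by fact
    show "\<not> p dvd 1"
    proof
      assume "p dvd 1"
      then obtain c where "p = [:c:]"
        by (auto simp: is_unit_poly_iff)
      moreover from this have "c \<noteq> 0" using \<open>p \<noteq> 0\<close> by auto
      ultimately show False using root by (simp add: map_poly_pCons)
    qed
    fix a b assume ab: "p = a * b"
    then have nz: "a \<noteq> 0" "b \<noteq> 0" using \<open>p \<noteq> 0\<close> by auto
    have "poly (map_poly of_rat a) z = 0 \<or> poly (map_poly of_rat b) z = 0"
      using root by (simp add: ab poly_of_rat_mult)
    then have "degree p \<le> degree a \<or> degree p \<le> degree b"
      using nz least deg by (auto simp: P_def)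
    moreover have "degree p = degree a + degree b" using nz by (simp add: ab degree_mult_eq)
    ultimately have "degree b = 0 \<or> degree a = 0" by auto
    then show "a dvd 1 \<or> b dvd 1" using nz by (auto simp: is_unit_iff_degree)
  qed
  show ?thesis
  proof (rule ex1I[of _ p])
    from mono root \<open>irreducible p\<close>
    show "lead_coeff p = 1 \<and> irreducible p \<and> poly (map_poly of_rat p) z = 0"
      by blast
    fix s :: "rat poly"
    assume s: "lead_coeff s = 1 \<and> irreducible s \<and> poly (map_poly of_rat s) z = 0"
    have "poly (map_poly of_rat (s div p * p + s mod p)) z = 0"
      using s by simp
    then have "poly (map_poly of_rat (s mod p)) z = 0"
      using root by (simp only: poly_of_rat_add poly_of_rat_mult) simp
    then have "s mod p = 0"
      using degree_mod_less[OF \<open>p \<noteq> 0\<close>, of s] least[of "s mod p"] deg by (force simp: P_def)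
    then obtain t where t: "s = p * t" by auto
    have "\<not> p dvd 1" using \<open>irreducible p\<close> irreducible_not_unit by blast
    then have "t dvd 1" using s t irreducibleD by blast
    then obtain e where "t = [:e:]" by (auto simp: is_unit_poly_iff)
    moreover from this have "e = 1" using s t mono by (auto split: if_splits)
    ultimately show "s = p" using t by simp
  qed
qed

definition rat_conjugates :: "complex \<Rightarrow> complex set" where
  "rat_conjugates z = {w. poly (map_poly of_rat (rat_min_poly z)) w = 0}"

definition totally_real_cubic :: "complex \<Rightarrow> bool" where
  "totally_real_cubic z \<longleftrightarrow>
     algebraic z \<and> degree (rat_min_poly z) = 3 \<and> rat_conjugates z \<subseteq> \<real>"

definition real_quadratic :: "complex \<Rightarrow> bool" where
  "real_quadratic z \<longleftrightarrow> algebraic z \<and> z \<in> \<real> \<and> degree (rat_min_poly z) = 2"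

definition I3tr :: "int \<Rightarrow> int \<Rightarrow> real set" where
  "I3tr m n = {\<alpha> \<in> {0<..<1}. \<exists>d :: int. 1 \<le> d \<and> d \<le> - m - n - 2 \<and>
     \<alpha> ^ 3 + of_int m * \<alpha>\<^sup>2 + of_int n * \<alpha> + of_int d = 0}"

text \<open>Only the arguments \<open>b \<in> {0, -1, -2, -3}\<close> are relevant for the following two functions.\<close>

definition delta :: "int \<Rightarrow> int" where
  "delta b = (if b = 0 \<or> b = -1 then 1 else 0)"

definition epsilon :: "int \<Rightarrow> int" where
  "epsilon b = (if b = 0 then 1 else 0)"

definition all_cubic_form :: "int \<Rightarrow> int \<Rightarrow> bool" where
  "all_cubic_form b c \<longleftrightarrow>
     (\<exists>n. n \<ge> delta b \<and> c = - n\<^sup>2 + (b - 1) * n - 1) \<or>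
     (\<exists>n. n \<ge> 1 + epsilon b - epsilon (- 3 - b) \<and> c = - n\<^sup>2 + b * n)"

definition quadratic_range :: "int \<Rightarrow> int \<Rightarrow> int \<Rightarrow> bool" where
  "quadratic_range b c n \<longleftrightarrow>
     (n \<ge> 1 + epsilon b \<and> - n\<^sup>2 + (b - 1) * n - 1 < c \<and> c < - n\<^sup>2 + b * n) \<or>
     (n \<le> - 3 - epsilon (- 3 - b) \<and> - n\<^sup>2 + b * n < c \<and> c < - n\<^sup>2 + (b - 1) * n - 1)"

end

theory Submission
  imports Defs "HOL-Computational_Algebra.Field_as_Ring"
begin

text \<open>
  Write \<open>f\<^sub>d = x\<^sup>3 + b x\<^sup>2 + c x + d\<close>. Each \<open>f\<^sub>d\<close> has roots \<open>\<alpha> \<in> (0, 1)\<close>, \<open>\<rho> > 1\<close>, \<open>\<sigma> < 0\<close>, so it is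
  irreducible unless it has an integer root \<open>n - b\<close>; then \<open>\<alpha>\<close> is a root of
  \<open>x\<^sup>2 + n x + (c + n\<^sup>2 - b n)\<close>, and the signs of this quadratic at \<open>0\<close> and \<open>1\<close> put \<open>c\<close> into one of the
  intervals of the statement. These intervals interlace, leaving out only their end points.

  Let \<open>\<alpha> < \<beta>\<close> be cubic with \<open>\<rat>(\<alpha>) = \<rat>(\<beta>)\<close>. As \<open>\<alpha>\<close> grows, \<open>\<rho>\<close> and \<open>\<sigma>\<close> decrease, with constant sum
  \<open>\<alpha> + \<rho> + \<sigma>\<close>. If the conjugation taking \<open>\<alpha>\<close> to \<open>\<rho>\<close> takes \<open>\<beta>\<close> to \<open>\<rho>'\<close>, then all conjugates of the
  algebraic integer \<open>\<beta> - \<alpha>\<close> are nonzero and less than \<open>1\<close> in absolute value, which contradicts the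
  integrality of the norm. Otherwise \<open>\<alpha> + \<beta>\<close> is conjugate to \<open>\<rho> + \<sigma>'\<close> and \<open>\<sigma> + \<rho>'\<close>, both of which lie
  in \<open>(- b - 1, - b)\<close>; for \<open>- 3 \<le> b \<le> 0\<close> the norms of \<open>\<alpha> + \<beta> + t\<close> cannot all be integers.
\<close>

section \<open>Rational polynomials and simple extensions\<close>

text \<open>The target field is left general because roots are used both as reals, where they are
  ordered, and as complex numbers, where minimal polynomials and fields are defined.\<close>

abbreviation rpoly :: "rat poly \<Rightarrow> 'a :: field_char_0 \<Rightarrow> 'a" where
  "rpoly p \<equiv> poly (map_poly of_rat p)"

lemma rpoly_add: "rpoly (p + q) x = rpoly p x + rpoly q x"
proof -
  have "map_poly of_rat (p + q) = map_poly of_rat p + (map_poly of_rat q :: 'a poly)"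
    by (rule poly_eqI) (simp add: coeff_map_poly of_rat_add)
  then show ?thesis by simp
qed

lemma rpoly_mult: "rpoly (p * q) x = rpoly p x * rpoly q x"
proof -
  have "map_poly of_rat (p * q) = map_poly of_rat p * (map_poly of_rat q :: 'a poly)"
    by (rule poly_eqI) (simp add: coeff_map_poly coeff_mult of_rat_sum of_rat_mult)
  then show ?thesis by simp
qed

lemma rpoly_minus: "rpoly (- p) x = - rpoly p x"
  using rpoly_add[of p "- p" x] by (simp add: add_eq_0_iff)

lemma rpoly_diff: "rpoly (p - q) x = rpoly p x - rpoly q x"
  using rpoly_add[of p "- q" x] by (simp add: rpoly_minus)

lemma rpoly_pcompose: "rpoly (pcompose p q) x = rpoly p (rpoly q x)"
  by (induction p) (auto simp: pcompose_pCons rpoly_add rpoly_mult map_poly_pCons)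

lemma rpoly_of_real:
  "rpoly p (of_real x :: complex) = of_real (rpoly p x)"
proof (induction p)
  case (pCons a p)
  have "(of_rat a :: complex) = of_real (of_rat a)"
    by (cases a) (simp add: of_rat_rat)
  with pCons show ?case
    by (simp add: map_poly_pCons)
qed auto

lemma irreducible_bezout:
  fixes p q :: "rat poly"
  assumes "irreducible p" "\<not> p dvd q"
  obtains u v where "u * p + v * q = 1"
proof -
  have "prime_elem p"
    using assms(1) by (rule irreducible_imp_prime_elem)
  then have "coprime p q"
    using assms(2) by (rule prime_elem_imp_coprime)
  then have "gcd p q = 1" by simp
  then show thesis
    using that bezout_coefficients_fst_snd[of p q] by metis
qed

text \<open>At a common root a Bezout identity \<open>u * p + v * q = 1\<close> would read
  \<open>0 = 1\<close>.\<close>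

lemma irreducible_dvd_if_common_root:
  fixes x :: "'a :: field_char_0"
  assumes p: "irreducible p" "rpoly p x = 0" and q: "rpoly q x = 0"
  shows "p dvd q"
proof (rule ccontr)
  assume "\<not> p dvd q"
  with p(1) obtain u v where "u * p + v * q = 1"
    by (rule irreducible_bezout)
  then have "rpoly (u * p + v * q) x = 1"
    by simp
  with p(2) q show False
    by (simp add: rpoly_add rpoly_mult)
qed

lemma algebraic_rpoly_root:
  assumes "p \<noteq> 0" "rpoly p (z :: complex) = 0"
  shows "algebraic z"
  unfolding algebraic_altdef
proof (intro exI conjI)
  show "\<forall>i. coeff (map_poly of_rat p :: complex poly) i \<in> \<rat>"
    by (simp add: coeff_map_poly)
  show "map_poly of_rat p \<noteq> (0 :: complex poly)"
    using assms(1) by (simp add: map_poly_eq_0_iff)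
  show "rpoly p z = 0" by fact
qed

lemma rat_min_poly_eq:
  assumes "lead_coeff p = 1" "irreducible p" "rpoly p z = 0"
  shows "rat_min_poly z = p" and "algebraic z"
proof -
  show alg: "algebraic z"
    using assms(1,3) by (intro algebraic_rpoly_root[of p]) auto
  show "rat_min_poly z = p"
    unfolding rat_min_poly_def using assms ex1_rat_min_poly[OF alg] by (intro the1_equality) auto
qed

lemma rat_adjoin_generator: "z \<in> rat_adjoin z"
  by (simp add: rat_adjoin_def hull_inc)

text \<open>The polynomial expressions in \<open>z\<close> already form a field, since a Bezout
  identity with \<open>p\<close>, evaluated at \<open>z\<close>, supplies inverses; hence the
  generated field is no larger.\<close>

lemma rat_adjoin_irreducible_root:
  assumes "irreducible p" "rpoly p z = 0" "w \<in> rat_adjoin z"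
  obtains q where "w = rpoly q z"
proof -
  define K where "K = range (\<lambda>q. rpoly q z)"
  have inv: "\<exists>r. inverse (rpoly q z) = rpoly r z" for q
  proof (cases "rpoly q z = 0")
    \<comment> \<open>The convention \<open>inverse 0 = 0\<close> is covered by the zero
      polynomial.\<close>
    case True
    then show ?thesis by (intro exI[of _ 0]) simp
  next
    case False
    with assms(2) have "\<not> p dvd q"
      by (auto simp: rpoly_mult)
    with assms(1) obtain u v where "u * p + v * q = 1"
      by (rule irreducible_bezout)
    then have "rpoly (u * p + v * q) z = 1"
      by simp
    with assms(2) False have "inverse (rpoly q z) = rpoly v z"
      by (simp add: rpoly_add rpoly_mult field_simps)
    then show ?thesis by blast
  qed
  have "is_subfield K"
    unfolding is_subfield_def
  proof (intro conjI ballI)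
    show "0 \<in> K" unfolding K_def by (intro range_eqI[of _ _ 0]) simp
    show "1 \<in> K" unfolding K_def by (intro range_eqI[of _ _ 1]) simp
  next
    fix x y assume "x \<in> K" "y \<in> K"
    then obtain u v where "x = rpoly u z" "y = rpoly v z" by (auto simp: K_def)
    then show "x + y \<in> K" "x * y \<in> K"
      unfolding K_def using rpoly_add[of u v z] rpoly_mult[of u v z] by (metis rangeI)+
  next
    fix x assume "x \<in> K"
    then obtain u where "x = rpoly u z" by (auto simp: K_def)
    then show "- x \<in> K" "inverse x \<in> K"
      unfolding K_def using rpoly_minus[of u z] inv[of u] by (metis rangeI)+
  qed
  moreover have "z \<in> K"
    unfolding K_def by (intro range_eqI[of _ _ "[:0, 1:]"]) (simp add: map_poly_pCons)
  ultimately have "rat_adjoin z \<subseteq> K"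
    unfolding rat_adjoin_def by (intro hull_minimal) auto
  with assms(3) show thesis
    using that by (auto simp: K_def)
qed

lemma degree_1_poly_root_rat:
  assumes "degree p = 1"
  obtains r where "\<And>x :: 'a :: field_char_0. rpoly p x = 0 \<longleftrightarrow> x = of_rat r"
proof -
  obtain u v where p: "p = [:u, v:]" "v \<noteq> 0"
  proof (cases p)
    case (pCons u q)
    with assms have "degree q = 0" "q \<noteq> 0"
      by (auto split: if_splits)
    then show thesis
      using pCons that by (auto elim!: degree_eq_zeroE)
  qed
  have "rpoly p x = (x - of_rat (- u / v)) * of_rat v" for x :: 'a
    using p(2) by (simp add: p(1) map_poly_pCons of_rat_divide of_rat_minus distrib_right)
  with p(2) have "rpoly p x = 0 \<longleftrightarrow> x = of_rat (- u / v)" for x :: 'a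
    by simp
  then show thesis by (rule that)
qed

text \<open>A nontrivial factorisation consists of two linear factors, whose only roots are
  rational.\<close>

lemma irreducible_quadratic:
  fixes x :: "'a :: field_char_0"
  assumes "degree p = 2" "rpoly p x = 0" "x \<notin> \<rat>"
  shows "irreducible p"
proof (rule irreducibleI)
  show nz: "p \<noteq> 0"
    using assms(1) by auto
  then show "\<not> p dvd 1"
    using assms(1) by (simp add: is_unit_iff_degree)
  fix u v assume uv: "p = u * v"
  then have "u \<noteq> 0" "v \<noteq> 0" and "degree u + degree v = 2"
    using nz assms(1) degree_mult_eq[of u v] by auto
  moreover have "\<not> (degree u = 1 \<and> degree v = 1)"
  proof
    assume "degree u = 1 \<and> degree v = 1"
    then have "\<exists>r. \<forall>x::'a. rpoly u x = 0 \<longleftrightarrow> x = of_rat r" "\<exists>r. \<forall>x::'a. rpoly v x = 0 \<longleftrightarrow> x = of_rat r"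
      by (metis degree_1_poly_root_rat)+
    with assms(2,3) show False
      unfolding uv rpoly_mult by auto
  qed
  ultimately show "u dvd 1 \<or> v dvd 1"
    by (simp add: is_unit_iff_degree) linarith
qed

lemma irreducible_cubic:
  fixes p :: "rat poly"
  assumes "degree p = 3" "\<And>r. poly p r \<noteq> 0"
  shows "irreducible p"
proof (rule irreducibleI)
  show nz: "p \<noteq> 0"
    using assms(1) by auto
  then show "\<not> p dvd 1"
    using assms(1) by (simp add: is_unit_iff_degree)
  fix u v assume uv: "p = u * v"
  then have nz': "u \<noteq> 0" "v \<noteq> 0" and "degree u + degree v = 3"
    using nz assms(1) degree_mult_eq[of u v] by auto
  have "degree w \<noteq> 1" if w: "w dvd p" for w
  proof
    assume "degree w = 1"
    then obtain r where "\<And>x :: rat. rpoly w x = 0 \<longleftrightarrow> x = of_rat r"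
      by (rule degree_1_poly_root_rat) blast
    then have "rpoly w r = 0" by simp
    with w have "rpoly p r = 0" by (auto simp: rpoly_mult)
    moreover have "map_poly of_rat p = p"
      by (rule poly_eqI) (simp add: coeff_map_poly)
    ultimately show False using assms(2) by auto
  qed
  from this[of u] this[of v] have "degree u \<noteq> 1" "degree v \<noteq> 1"
    by (simp_all add: uv)
  with \<open>degree u + degree v = 3\<close> nz' show "u dvd 1 \<or> v dvd 1"
    by (simp add: is_unit_iff_degree) linarith
qed

section \<open>Integrality of norms\<close>

text \<open>The left side is the norm of \<open>u + v * x + w * x\<^sup>2\<close>. Being symmetric
  in the roots, it is an integral polynomial in \<open>u\<close>, \<open>v\<close>, \<open>w\<close>
  and the elementary symmetric functions, and so is integral or rational when they are.\<close>

lemma prod_quadratics_eq: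
  fixes x y z u v w a b c :: "'a :: comm_ring_1"
  assumes "x + y + z = a" "x * y + x * z + y * z = b" "x * y * z = c"
  shows "(u + v * x + w * x\<^sup>2) * (u + v * y + w * y\<^sup>2) * (u + v * z + w * z\<^sup>2) =
    u^3 + u\<^sup>2 * v * a + u\<^sup>2 * w * (a\<^sup>2 - 2 * b) + u * v\<^sup>2 * b + u * v * w * (a * b - 3 * c) +
    u * w\<^sup>2 * (b\<^sup>2 - 2 * a * c) + v^3 * c + v\<^sup>2 * w * a * c + v * w\<^sup>2 * b * c + w^3 * c\<^sup>2"
  unfolding assms[symmetric] by (simp add: algebra_simps power2_eq_square power3_eq_cube)

lemma prod_quadratics_in_Ints:
  fixes x y z :: real
  assumes e: "x + y + z \<in> \<int>" "x * y + x * z + y * z \<in> \<int>" "x * y * z \<in> \<int>"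
    and "u \<in> \<int>" "v \<in> \<int>" "w \<in> \<int>"
  shows "(u + v * x + w * x\<^sup>2) * (u + v * y + w * y\<^sup>2) * (u + v * z + w * z\<^sup>2) \<in> \<int>"
proof -
  obtain a b c where abc: "x + y + z = a" "x * y + x * z + y * z = b" "x * y * z = c"
    by blast
  show ?thesis
    unfolding prod_quadratics_eq[OF abc] using assms unfolding abc by auto
qed

lemma prod_quadratics_in_Rats:
  fixes x y z :: real
  assumes e: "x + y + z \<in> \<rat>" "x * y + x * z + y * z \<in> \<rat>" "x * y * z \<in> \<rat>"
    and "u \<in> \<rat>" "v \<in> \<rat>" "w \<in> \<rat>"
  shows "(u + v * x + w * x\<^sup>2) * (u + v * y + w * y\<^sup>2) * (u + v * z + w * z\<^sup>2) \<in> \<rat>"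
proof -
  obtain a b c where abc: "x + y + z = a" "x * y + x * z + y * z = b" "x * y * z = c"
    by blast
  show ?thesis
    unfolding prod_quadratics_eq[OF abc] using assms unfolding abc by auto
qed

text \<open>If \<open>x\<close> has denominator \<open>b\<close> in lowest terms, every power of
  \<open>b\<close> divides \<open>D\<close>, which is impossible unless
  \<open>b = 1\<close>.\<close>

lemma Ints_if_common_denominator_powers:
  fixes x :: real
  assumes "x \<in> \<rat>" and D: "D \<noteq> 0" "\<And>k. of_int D * x ^ k \<in> \<int>"
  shows "x \<in> \<int>"
proof -
  obtain r where "x = of_rat r" using assms(1) by (auto elim: Rats_cases)
  moreover obtain a b where "r = Rat.Fract a b" and b: "b > 0" "coprime a b"
    by (cases r)
  ultimately have x: "x = of_int a / of_int b"
    by (simp add: of_rat_rat)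
  \<comment> \<open>With the exponent \<open>\<bar>D\<bar>\<close>, a denominator
    \<open>b \<ge> 2\<close> would give \<open>2 ^ k \<le> b ^ k \<le> k\<close>.\<close>
  define k where "k = nat \<bar>D\<bar>"
  obtain m where "of_int D * x ^ k = of_int m"
    using D(2) by (auto elim: Ints_cases)
  then have "(of_int (D * a ^ k) :: real) = of_int (m * b ^ k)"
    using b(1) by (simp add: x power_divide field_simps)
  then have "D * a ^ k = m * b ^ k"
    by (simp only: of_int_eq_iff)
  then have "b ^ k dvd D * a ^ k" by simp
  moreover have "coprime (b ^ k) (a ^ k)"
    using b(2) by (simp add: coprime_commute)
  ultimately have "b ^ k dvd D"
    using coprime_dvd_mult_left_iff by blast
  then have le: "b ^ k \<le> int k"
    using D(1) dvd_imp_le_int[of D "b ^ k"] b(1) by (simp add: k_def)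
  have "b = 1"
  proof (rule ccontr)
    assume "b \<noteq> 1"
    with b(1) have "(2 :: int) ^ k \<le> b ^ k"
      by (intro power_mono) auto
    moreover have "int k < 2 ^ k"
      by (metis less_exp of_nat_less_iff of_nat_numeral of_nat_power)
    ultimately show False using le by linarith
  qed
  then show ?thesis by (simp add: x)
qed

text \<open>On a set of roots of a monic integral cubic these functions are the elements of
  \<open>\<int>[x]\<close>, reduced to degree at most two; only the values on \<open>X\<close>
  matter.\<close>

definition int_quadratic_on :: "real set \<Rightarrow> (real \<Rightarrow> real) \<Rightarrow> bool" where
  "int_quadratic_on X f \<longleftrightarrow>
    (\<exists>u v w :: int. \<forall>x\<in>X. f x = of_int u + of_int v * x + of_int w * x\<^sup>2)"

lemma int_quadratic_on_const: "int_quadratic_on X (\<lambda>x. of_int u)"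
  unfolding int_quadratic_on_def by (intro exI[of _ u] exI[of _ 0]) simp

lemma int_quadratic_on_add:
  assumes "int_quadratic_on X f" "int_quadratic_on X g"
  shows "int_quadratic_on X (\<lambda>x. f x + g x)"
proof -
  obtain u v w u' v' w' :: int
    where "\<forall>x\<in>X. f x = of_int u + of_int v * x + of_int w * x\<^sup>2"
      and "\<forall>x\<in>X. g x = of_int u' + of_int v' * x + of_int w' * x\<^sup>2"
    using assms unfolding int_quadratic_on_def by blast
  then show ?thesis
    unfolding int_quadratic_on_def
    by (intro exI[of _ "u + u'"] exI[of _ "v + v'"] exI[of _ "w + w'"]) (simp add: algebra_simps)
qed

lemma int_quadratic_on_scale:
  assumes "int_quadratic_on X f"
  shows "int_quadratic_on X (\<lambda>x. of_int m * f x)"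
proof -
  obtain u v w :: int where "\<forall>x\<in>X. f x = of_int u + of_int v * x + of_int w * x\<^sup>2"
    using assms unfolding int_quadratic_on_def by blast
  then show ?thesis
    unfolding int_quadratic_on_def
    by (intro exI[of _ "m * u"] exI[of _ "m * v"] exI[of _ "m * w"]) (simp add: algebra_simps)
qed

locale cubic_roots =
  fixes X :: "real set" and a b c :: int
  assumes cubic: "x \<in> X \<Longrightarrow> x ^ 3 + of_int a * x\<^sup>2 + of_int b * x + of_int c = 0"
begin

lemma int_quadratic_on_shift:
  assumes "int_quadratic_on X f"
  shows "int_quadratic_on X (\<lambda>x. x * f x)"
proof -
  obtain u v w :: int where f: "\<forall>x\<in>X. f x = of_int u + of_int v * x + of_int w * x\<^sup>2"
    using assms unfolding int_quadratic_on_def by blast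
  have "x * f x = of_int (- c * w) + of_int (u - b * w) * x + of_int (v - a * w) * x\<^sup>2"
    if "x \<in> X" for x
  proof -
    have "x ^ 3 = - of_int a * x\<^sup>2 - of_int b * x - of_int c"
      using cubic[OF that] by simp
    moreover have "x * f x = of_int u * x + of_int v * x\<^sup>2 + of_int w * x ^ 3"
      using f that by (simp add: algebra_simps power2_eq_square power3_eq_cube)
    ultimately have "x * f x = of_int u * x + of_int v * x\<^sup>2 +
        of_int w * (- of_int a * x\<^sup>2 - of_int b * x - of_int c)"
      by simp
    then show ?thesis
      by (simp add: algebra_simps)
  qed
  then show ?thesis unfolding int_quadratic_on_def by blast
qed

lemma int_quadratic_on_mult:
  assumes "int_quadratic_on X f" "int_quadratic_on X g"
  shows "int_quadratic_on X (\<lambda>x. f x * g x)"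
proof -
  obtain u v w :: int where f: "\<forall>x\<in>X. f x = of_int u + of_int v * x + of_int w * x\<^sup>2"
    using assms unfolding int_quadratic_on_def by blast
  have "int_quadratic_on X (\<lambda>x. of_int u * g x + of_int v * (x * g x) + of_int w * (x * (x * g x)))"
    using assms(2) by (intro int_quadratic_on_add int_quadratic_on_scale int_quadratic_on_shift)
  moreover have "f x * g x = of_int u * g x + of_int v * (x * g x) + of_int w * (x * (x * g x))"
    if "x \<in> X" for x
    using f that by (simp add: algebra_simps power2_eq_square)
  ultimately show ?thesis
    unfolding int_quadratic_on_def by simp
qed

text \<open>The monic integral equation for \<open>g\<close> keeps all powers in the span of
  \<open>1\<close>, \<open>g\<close>, \<open>g\<^sup>2\<close> over the integral quadratics. Hence a
  denominator \<open>D\<close> of \<open>g\<close> controls all of them: \<open>D\<^sup>2\<close>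
  suffices uniformly in \<open>k\<close>.\<close>

lemma int_quadratic_on_powers:
  fixes s t p q r D :: int and g :: "real \<Rightarrow> real"
  assumes g: "\<And>x. x \<in> X \<Longrightarrow> g x ^ 3 + of_int p * (g x)\<^sup>2 + of_int q * g x + of_int r = 0"
    and D: "int_quadratic_on X (\<lambda>x. of_int D * g x)"
  shows "int_quadratic_on X (\<lambda>x. of_int (D\<^sup>2) * (g x + of_int s * x + of_int t) ^ k)"
proof -
  have "\<exists>f0 f1 f2. int_quadratic_on X f0 \<and> int_quadratic_on X f1 \<and> int_quadratic_on X f2 \<and>
    (\<forall>x\<in>X. (g x + of_int s * x + of_int t) ^ k = f0 x + f1 x * g x + f2 x * (g x)\<^sup>2)"
  proof (induction k)
    case 0
    show ?case
      using int_quadratic_on_const[of X 0] int_quadratic_on_const[of X 1]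
      by (intro exI[of _ "\<lambda>_. 0"] exI[of _ "\<lambda>_. 1"]) simp
  next
    case (Suc k)
    then obtain f0 f1 f2
      where f: "int_quadratic_on X f0" "int_quadratic_on X f1" "int_quadratic_on X f2"
        and eq: "\<forall>x\<in>X. (g x + of_int s * x + of_int t) ^ k = f0 x + f1 x * g x + f2 x * (g x)\<^sup>2"
      by blast
    \<comment> \<open>\<open>lin\<close> is multiplication by \<open>s * x + t\<close>;
      multiplication by \<open>g\<close> shifts the coefficients, and its equation folds
      \<open>g ^ 3\<close> back.\<close>
    define lin where "lin f = (\<lambda>x. of_int s * (x * f x) + of_int t * f x)" for f :: "real \<Rightarrow> real"
    have lin: "int_quadratic_on X (lin f)" if "int_quadratic_on X f" for f
      unfolding lin_def using that
      by (intro int_quadratic_on_add int_quadratic_on_scale int_quadratic_on_shift)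
    have "int_quadratic_on X (\<lambda>x. lin f0 x + of_int (- r) * f2 x)"
      "int_quadratic_on X (\<lambda>x. lin f1 x + f0 x + of_int (- q) * f2 x)"
      "int_quadratic_on X (\<lambda>x. lin f2 x + f1 x + of_int (- p) * f2 x)"
      by (intro int_quadratic_on_add int_quadratic_on_scale lin f)+
    moreover have "(g x + of_int s * x + of_int t) ^ Suc k =
        (lin f0 x + of_int (- r) * f2 x) + (lin f1 x + f0 x + of_int (- q) * f2 x) * g x +
        (lin f2 x + f1 x + of_int (- p) * f2 x) * (g x)\<^sup>2" if x: "x \<in> X" for x
    proof -
      have "g x ^ 3 = - of_int p * (g x)\<^sup>2 - of_int q * g x - of_int r"
        using g[OF x] by simp
      moreover have "(g x + of_int s * x + of_int t) ^ Suc k =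
          (g x + of_int s * x + of_int t) * (f0 x + f1 x * g x + f2 x * (g x)\<^sup>2)"
        using eq x by simp
      moreover have "\<dots> = lin f0 x + (lin f1 x + f0 x) * g x + (lin f2 x + f1 x) * (g x)\<^sup>2 + f2 x * g x ^ 3"
        unfolding lin_def by (simp add: algebra_simps power2_eq_square power3_eq_cube)
      ultimately have "(g x + of_int s * x + of_int t) ^ Suc k =
          lin f0 x + (lin f1 x + f0 x) * g x + (lin f2 x + f1 x) * (g x)\<^sup>2 +
          f2 x * (- of_int p * (g x)\<^sup>2 - of_int q * g x - of_int r)"
        by simp
      then show ?thesis by (simp add: algebra_simps)
    qed
    ultimately show ?case by blast
  qed
  then obtain f0 f1 f2
    where f: "int_quadratic_on X f0" "int_quadratic_on X f1" "int_quadratic_on X f2"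
      and eq: "\<forall>x\<in>X. (g x + of_int s * x + of_int t) ^ k = f0 x + f1 x * g x + f2 x * (g x)\<^sup>2"
    by blast
  let ?h = "\<lambda>x. of_int D * g x"
  \<comment> \<open>One factor \<open>D\<close> is absorbed by \<open>g\<close> and two by its
    square.\<close>
  have "int_quadratic_on X (\<lambda>x. of_int (D\<^sup>2) * f0 x + of_int D * (f1 x * ?h x) + f2 x * (?h x * ?h x))"
    by (rule int_quadratic_on_add int_quadratic_on_scale f int_quadratic_on_mult D)+
  moreover have "of_int (D\<^sup>2) * (g x + of_int s * x + of_int t) ^ k =
      of_int (D\<^sup>2) * f0 x + of_int D * (f1 x * ?h x) + f2 x * (?h x * ?h x)" if "x \<in> X" for x
    using eq that by (simp add: algebra_simps power2_eq_square)
  ultimately show ?thesis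
    unfolding int_quadratic_on_def by simp
qed

end

text \<open>
  The powers of \<open>g x + s x + t\<close> lie in the finitely generated module \<open>\<int>[x, g x]\<close>, so they have a
  common denominator with respect to \<open>\<int>[x]\<close>, and hence so do the powers of the norm.
\<close>

lemma norm_in_Ints:
  fixes x y z :: real and u v w :: rat and a b c p q r s t :: int
  assumes e: "x + y + z = of_int a" "x * y + x * z + y * z = of_int b" "x * y * z = of_int c"
    and g_def: "\<And>x. g x = of_rat u + of_rat v * x + of_rat w * x\<^sup>2"
    and g: "\<And>\<xi>. \<xi> \<in> {x, y, z} \<Longrightarrow> g \<xi> ^ 3 + of_int p * (g \<xi>)\<^sup>2 + of_int q * g \<xi> + of_int r = 0"
  shows "(g x + of_int s * x + of_int t) * (g y + of_int s * y + of_int t) *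
    (g z + of_int s * z + of_int t) \<in> \<int>" (is "?n \<in> _")
proof -
  have "?n = (of_rat (u + of_int t) + of_rat (v + of_int s) * x + of_rat w * x\<^sup>2) *
      (of_rat (u + of_int t) + of_rat (v + of_int s) * y + of_rat w * y\<^sup>2) *
      (of_rat (u + of_int t) + of_rat (v + of_int s) * z + of_rat w * z\<^sup>2)"
    by (simp add: g_def of_rat_add algebra_simps)
  also have "\<dots> \<in> \<rat>"
    by (rule prod_quadratics_in_Rats) (simp_all add: e)
  finally have rat: "?n \<in> \<rat>" .
  interpret cubic_roots "{x, y, z}" "- a" b "- c"
  proof
    fix \<xi> assume "\<xi> \<in> {x, y, z}"
    then have "(\<xi> - x) * (\<xi> - y) * (\<xi> - z) = 0" by auto
    then have "\<xi> ^ 3 + - (x + y + z) * \<xi>\<^sup>2 + (x * y + x * z + y * z) * \<xi> + - (x * y * z) = 0"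
      by algebra
    then show "\<xi> ^ 3 + of_int (- a) * \<xi>\<^sup>2 + of_int b * \<xi> + of_int (- c) = 0"
      by (simp only: e of_int_minus)
  qed
  obtain D :: int where D: "D > 0" "of_int D * u \<in> \<int>" "of_int D * v \<in> \<int>" "of_int D * w \<in> \<int>"
  proof -
    have "\<exists>d n. d > 0 \<and> of_int d * r = of_int n" for r :: rat
      by (cases r) (force simp: Fract_of_int_quotient)
    then obtain d d' d'' n n' n'' :: int where *: "d > 0" "d' > 0" "d'' > 0"
      "of_int d * u = of_int n" "of_int d' * v = of_int n'" "of_int d'' * w = of_int n''"
      by metis
    have "of_int (d * d' * d'') * u = of_int (d' * d'' * n)"
      "of_int (d * d' * d'') * v = of_int (d * d'' * n')"
      "of_int (d * d' * d'') * w = of_int (d * d' * n'')"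
      by (simp_all flip: *(4-6))
    with *(1-3) show thesis
      by (intro that[of "d * d' * d''"]) (simp_all only: Ints_of_int mult_pos_pos)
  qed
  obtain u' v' w' where "of_int D * u = of_int u'" "of_int D * v = of_int v'" "of_int D * w = of_int w'"
    using D(2-4) by (auto elim!: Ints_cases)
  then have Duvw: "of_rat (of_int D * u) = (of_int u' :: real)"
    "of_rat (of_int D * v) = (of_int v' :: real)" "of_rat (of_int D * w) = (of_int w' :: real)"
    by simp_all
  have "of_int D * g \<xi> = of_int u' + of_int v' * \<xi> + of_int w' * \<xi>\<^sup>2" for \<xi>
    unfolding g_def Duvw[symmetric] by (simp add: of_rat_mult algebra_simps)
  then have D_quadratic: "int_quadratic_on {x, y, z} (\<lambda>x. of_int D * g x)"
    unfolding int_quadratic_on_def by blast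
  \<comment> \<open>Each of the three conjugate factors costs one \<open>D\<^sup>2\<close>,
    independently of \<open>k\<close>.\<close>
  have int: "of_int ((D\<^sup>2) ^ 3) * ?n ^ k \<in> \<int>" for k
  proof -
    have "int_quadratic_on {x, y, z} (\<lambda>x. of_int (D\<^sup>2) * (g x + of_int s * x + of_int t) ^ k)"
      using g D_quadratic by (intro int_quadratic_on_powers)
    then obtain U V W :: int where *:
      "\<And>\<xi>. \<xi> \<in> {x, y, z} \<Longrightarrow> of_int (D\<^sup>2) * (g \<xi> + of_int s * \<xi> + of_int t) ^ k =
        of_int U + of_int V * \<xi> + of_int W * \<xi>\<^sup>2"
      unfolding int_quadratic_on_def by blast
    have "of_int ((D\<^sup>2) ^ 3) * ?n ^ k =
        (of_int (D\<^sup>2) * (g x + of_int s * x + of_int t) ^ k) *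
        (of_int (D\<^sup>2) * (g y + of_int s * y + of_int t) ^ k) *
        (of_int (D\<^sup>2) * (g z + of_int s * z + of_int t) ^ k)"
      by (simp add: power_mult_distrib power3_eq_cube)
    also have "\<dots> = (of_int U + of_int V * x + of_int W * x\<^sup>2) *
        (of_int U + of_int V * y + of_int W * y\<^sup>2) * (of_int U + of_int V * z + of_int W * z\<^sup>2)"
      using *[of x] *[of y] *[of z] by simp
    also have "\<dots> \<in> \<int>"
      by (rule prod_quadratics_in_Ints) (simp_all add: e)
    finally show ?thesis .
  qed
  show ?thesis
    by (rule Ints_if_common_denominator_powers[OF rat _ int]) (use D(1) in simp)
qed

section \<open>Real roots of the cubics\<close>

text \<open>The other two roots are those of the quotient \<open>x^2 + s * x + q\<close> of the
  cubic by \<open>x - \<alpha>\<close>. The bounds on \<open>d\<close> make this quotient negative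
  at 0 and at 1, so its roots lie on either side of the unit interval.\<close>

lemma I3tr_roots:
  assumes "\<alpha> \<in> I3tr m n"
  obtains d :: int and \<rho> \<sigma> :: real
  where "0 < \<alpha>" "\<alpha> < 1" "1 < \<rho>" "\<sigma> < 0" "1 \<le> d" "d \<le> - m - n - 2"
    and "\<alpha> + \<rho> + \<sigma> = of_int (- m)" "\<alpha> * \<rho> + \<alpha> * \<sigma> + \<rho> * \<sigma> = of_int n" "\<alpha> * \<rho> * \<sigma> = of_int (- d)"
proof -
  from assms obtain d where \<alpha>: "0 < \<alpha>" "\<alpha> < 1" and d: "1 \<le> d" "d \<le> - m - n - 2"
    and root: "\<alpha> ^ 3 + of_int m * \<alpha>\<^sup>2 + of_int n * \<alpha> + of_int d = 0"
    by (auto simp: I3tr_def)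
  define s q where "s = of_int m + \<alpha>" and "q = \<alpha>\<^sup>2 + of_int m * \<alpha> + of_int n"
  define r where "r = sqrt (s\<^sup>2 - 4 * q)"
  have q\<alpha>: "q * \<alpha> = - of_int d"
    using root by (simp add: q_def algebra_simps power2_eq_square power3_eq_cube)
  then have "q * \<alpha> < 0" using d(1) by simp
  then have q: "q < 0" using \<alpha>(1) by (simp add: mult_less_0_iff)
  have "0 \<le> s\<^sup>2 - 4 * q"
    using q zero_le_power2[of s] by linarith
  then have r2: "r\<^sup>2 = s\<^sup>2 - 4 * q"
    unfolding r_def by (rule real_sqrt_pow2)
  have "\<bar>s\<bar> < r"
    unfolding r_def using q by (intro real_less_rsqrt) simp
  then have \<sigma>: "(- s - r) / 2 < 0" by simp
  have sum: "(- s + r) / 2 + (- s - r) / 2 = - s" by (simp add: field_simps)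
  have prod: "(- s + r) / 2 * ((- s - r) / 2) = q"
    using r2 by (simp add: field_simps power2_eq_square)
  \<comment> \<open>Both sides are the value of the cubic at 1, which is at most -1.\<close>
  have "(1 - \<alpha>) * (1 + s + q) = 1 + of_int m + of_int n + of_int d"
    using root by (simp add: s_def q_def algebra_simps power2_eq_square power3_eq_cube)
  also have "\<dots> < 0" using d(2) by linarith
  finally have "1 + s + q < 0" using \<alpha>(2) by (simp add: mult_less_0_iff)
  moreover have "(1 - (- s + r) / 2) * (1 - (- s - r) / 2) = 1 + s + q"
    using prod sum by (simp add: algebra_simps)
  ultimately have "(1 - (- s + r) / 2) * (1 - (- s - r) / 2) < 0" by simp
  then have \<rho>: "1 < (- s + r) / 2"
    using \<sigma> by (simp add: mult_less_0_iff)
  show thesis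
  proof (rule that[OF \<alpha> \<rho> \<sigma> d])
    show "\<alpha> + (- s + r) / 2 + (- s - r) / 2 = of_int (- m)"
      using sum by (simp add: s_def)
    have "\<alpha> * ((- s + r) / 2) + \<alpha> * ((- s - r) / 2) + (- s + r) / 2 * ((- s - r) / 2) =
        \<alpha> * ((- s + r) / 2 + (- s - r) / 2) + (- s + r) / 2 * ((- s - r) / 2)"
      by (simp only: distrib_left)
    also have "\<dots> = \<alpha> * (- s) + q"
      by (simp only: sum prod)
    also have "\<dots> = of_int n"
      by (simp add: s_def q_def algebra_simps power2_eq_square)
    finally show "\<alpha> * ((- s + r) / 2) + \<alpha> * ((- s - r) / 2) + (- s + r) / 2 * ((- s - r) / 2) = of_int n" .
    show "\<alpha> * ((- s + r) / 2) * ((- s - r) / 2) = of_int (- d)"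
      using q\<alpha> unfolding prod[symmetric] by (simp only: ac_simps of_int_minus)
  qed
qed

lemma cubic_from_symmetric_functions:
  fixes x y z t a b c :: "'a :: comm_ring_1"
  assumes "x + y + z = - a" "x * y + x * z + y * z = b" "x * y * z = - c"
  shows "t ^ 3 + a * t\<^sup>2 + b * t + c = (t - x) * (t - y) * (t - z)"
proof -
  have *: "a = - (x + y + z)" "b = x * y + x * z + y * z" "c = - (x * y * z)"
    using assms by simp_all
  show ?thesis
    unfolding * by (simp add: algebra_simps power2_eq_square power3_eq_cube)
qed

text \<open>The two cubics differ only by a constant \<open>k\<close>, negative because
  \<open>\<beta>\<close> lies between \<open>\<alpha>\<close> and \<open>\<rho>\<close>. The first
  cubic is thus negative at \<open>\<rho>'\<close> and \<open>\<sigma>'\<close>, which places them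
  to the left of \<open>\<rho>\<close> and \<open>\<sigma>\<close>.\<close>

lemma roots_antimono:
  fixes \<alpha> \<beta> \<rho> \<sigma> \<rho>' \<sigma>' :: real
  assumes "0 < \<alpha>" "\<beta> < 1" "1 < \<rho>" "\<sigma> < 0" "1 < \<rho>'" "\<sigma>' < 0" and less: "\<alpha> < \<beta>"
    and sum: "\<alpha> + \<rho> + \<sigma> = \<beta> + \<rho>' + \<sigma>'"
    and pairs: "\<alpha> * \<rho> + \<alpha> * \<sigma> + \<rho> * \<sigma> = \<beta> * \<rho>' + \<beta> * \<sigma>' + \<rho>' * \<sigma>'"
  shows "\<rho>' < \<rho>" "\<sigma>' < \<sigma>"
proof -
  define k where "k = \<beta> * \<rho>' * \<sigma>' - \<alpha> * \<rho> * \<sigma>"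
  have k: "(t - \<alpha>) * (t - \<rho>) * (t - \<sigma>) = k" if "t \<in> {\<beta>, \<rho>', \<sigma>'}" for t
  proof -
    have "(t - \<beta>) * (t - \<rho>') * (t - \<sigma>') = 0" using that by auto
    moreover have "(t - \<alpha>) * (t - \<rho>) * (t - \<sigma>) = t ^ 3 - (\<alpha> + \<rho> + \<sigma>) * t\<^sup>2 +
        (\<alpha> * \<rho> + \<alpha> * \<sigma> + \<rho> * \<sigma>) * t - \<alpha> * \<rho> * \<sigma>"
      by (simp add: algebra_simps power2_eq_square power3_eq_cube)
    moreover have "(t - \<beta>) * (t - \<rho>') * (t - \<sigma>') = t ^ 3 - (\<beta> + \<rho>' + \<sigma>') * t\<^sup>2 +
        (\<beta> * \<rho>' + \<beta> * \<sigma>' + \<rho>' * \<sigma>') * t - \<beta> * \<rho>' * \<sigma>'"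
      by (simp add: algebra_simps power2_eq_square power3_eq_cube)
    ultimately show ?thesis
      using sum pairs unfolding k_def by simp
  qed
  have "(\<beta> - \<alpha>) * (\<beta> - \<rho>) * (\<beta> - \<sigma>) < 0"
    using assms by (intro mult_neg_pos mult_pos_neg) auto
  then have "k < 0" using k[of \<beta>] by simp
  then have "0 < ((\<rho>' - \<alpha>) * (\<rho>' - \<sigma>)) * (\<rho> - \<rho>')"
    "0 < ((\<alpha> - \<sigma>') * (\<rho> - \<sigma>')) * (\<sigma> - \<sigma>')"
    using k[of \<rho>'] k[of \<sigma>'] by (simp_all add: algebra_simps)
  moreover have "0 < (\<rho>' - \<alpha>) * (\<rho>' - \<sigma>)" "0 < (\<alpha> - \<sigma>') * (\<rho> - \<sigma>')"
    using assms by (auto intro!: mult_pos_pos)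
  ultimately show "\<rho>' < \<rho>" "\<sigma>' < \<sigma>"
    using zero_less_mult_pos diff_gt_0_iff_gt by meson+
qed

section \<open>Size estimates contradicting the integrality of norms\<close>

lemma not_Ints_between:
  fixes x :: real
  assumes "x \<in> \<int>" "of_int k < x" "x < of_int k + 1"
  shows False
  using assms by (auto elim!: Ints_cases)

text \<open>The norm lies strictly between 0 and 2, so it is 1, and the norm of \<open>x + 1\<close>
  then makes \<open>s\<^sup>2 - p\<close> an integer strictly between 0 and 3. Both remaining values
  are excluded by size.\<close>

lemma no_trace_zero_unit:
  fixes x y z :: real
  assumes y: "-1 < y" "y < 0" and z: "-1 < z" "z < 0" and sum: "x + y + z = 0"
    and int: "x * y * z \<in> \<int>" "(x + 1) * (y + 1) * (z + 1) \<in> \<int>"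
  shows False
proof -
  define s p where "s = - y - z" and "p = y * z"
  have s: "s = x" "0 < s" "s < 2" using y z sum by (auto simp: s_def)
  have p: "0 < p" "p < 1"
    using y z mult_strict_mono[of "- y" 1 "- z" 1] by (auto simp: p_def mult_neg_neg)
  have "0 < s * p" "s * p < 2"
    using s p mult_strict_mono[of s 2 p 1] by auto
  moreover have "s * p \<in> \<int>"
    using int(1) s(1) by (simp add: p_def mult.assoc)
  ultimately have sp: "s * p = 1" by (auto elim!: Ints_cases)
  have "(x + 1) * (y + 1) * (z + 1) = 2 + p - s\<^sup>2"
    using sp unfolding s(1)[symmetric] by (simp add: s_def p_def algebra_simps power2_eq_square)
  then have "s\<^sup>2 - p \<in> \<int>"
    using int(2) Ints_diff[of 2 "2 + p - s\<^sup>2"] by simp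
  then obtain k where k: "s\<^sup>2 - p = of_int k" by (auto elim: Ints_cases)
  \<comment> \<open>The discriminant \<open>(y - z)\<^sup>2\<close> is nonnegative, which yields
    \<open>s\<^sup>2 - p \<ge> 3 * p > 0\<close>.\<close>
  have disc: "4 * p \<le> s\<^sup>2"
    using zero_le_power2[of "y - z"] by (simp add: s_def p_def algebra_simps power2_eq_square)
  have "y\<^sup>2 < 1" "z\<^sup>2 < 1"
    using y z by (auto simp: abs_square_less_1)
  then have "s\<^sup>2 - p < 3"
    using p(2) by (simp add: s_def p_def algebra_simps power2_eq_square)
  then have "k < 3" "0 < k"
    using k disc p by linarith+
  then consider "k = 1" | "k = 2" by linarith
  then show False
  proof cases
    case 1
    then have "s\<^sup>2 = 1 + p" using k by simp
    with disc p have "1 < s\<^sup>2" "s\<^sup>2 < 2" "p \<le> 1 / 3" by linarith+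
    then have "s * p \<le> 2 * (1 / 3)"
      using s p by (intro mult_mono) auto
    with sp show False by simp
  next
    case 2
    then have "s * s = 2 + p" using k by (simp add: power2_eq_square)
    \<comment> \<open>This bounds \<open>s\<close> by \<open>1 + p\<close>, so that
      \<open>s\<^sup>2 < s + 1 < 2 + p\<close>.\<close>
    moreover have "0 < (1 + y) * (1 + z)" using y z by simp
    then have "s < 1 + p" by (simp add: s_def p_def algebra_simps)
    then have "s * s < s * (1 + p)" using s by (intro mult_strict_left_mono) auto
    moreover have "s * (1 + p) = s + 1" using sp by (simp add: algebra_simps)
    ultimately show False using \<open>s < 1 + p\<close> by linarith
  qed
qed

text \<open>This treats the conjugation that swaps the outer roots: \<open>x\<close> is
  \<open>\<alpha> + \<beta>\<close>, and \<open>y\<close>, \<open>z\<close> are its conjugates. For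
  each \<open>b\<close>, suitable integer translates either have norms too small to be nonzero
  integers or reduce to trace zero.\<close>

lemma swapped_norms_not_integral:
  fixes x y z :: real and b :: int
  assumes b: "-3 \<le> b" "b \<le> 0" and x: "0 < x" "x < 2"
    and y: "of_int (- b) - 1 < y" "y < of_int (- b)" and z: "of_int (- b) - 1 < z" "z < of_int (- b)"
    and sum: "x + y + z = of_int (- 2 * b)"
    and int: "\<And>t :: int. (x + of_int t) * (y + of_int t) * (z + of_int t) \<in> \<int>"
  shows False
proof -
  have small: "u * v * w = 0" if "\<bar>u\<bar> < 1" "\<bar>v\<bar> < 1" "\<bar>w\<bar> < 1" and int: "u * v * w \<in> \<int>" for u v w :: real
  proof -
    have "\<bar>u * v * w\<bar> < 1"
      using that mult_strict_mono'[of "\<bar>u\<bar>" 1 "\<bar>v\<bar>" 1] mult_strict_mono'[of "\<bar>u * v\<bar>" 1 "\<bar>w\<bar>" 1]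
      by (simp add: abs_mult)
    moreover obtain k where k: "u * v * w = of_int k"
      using int by (auto elim: Ints_cases)
    ultimately have "k = 0" by simp
    then show ?thesis by (simp add: k)
  qed
  have prod: "0 < u * v" "u * v < 1" if "0 < u" "u < 1" "0 < v" "v < 1" for u v :: real
    using that mult_strict_mono[of u 1 v 1] by auto
  consider "b = 0" | "b = -1" | "b = -2" | "b = -3" using b by linarith
  then show False
  proof cases
    case 1
    with y z sum int[of 0] int[of 1] show False
      by (intro no_trace_zero_unit[of y z x]) auto
  next
    case 2
    \<comment> \<open>In the translate by -1 all factors are less than 1 in absolute value, so the
      norm vanishes; only the factor \<open>x - 1\<close> can be zero.\<close>
    with x y z have "(x - 1) * (y - 1) * (z - 1) = 0"
      using int[of "-1"] by (intro small) auto
    with 2 y z have "x = 1" by simp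
    with 2 y z have "0 < x * y * z" "x * y * z < 1" using prod[of y z] by auto
    then show False using int[of 0] not_Ints_between[of "x * y * z" 0] by simp
  next
    case 3
    with x y z have "(x - 1) * (y - 1) * (z - 1) = 0"
      using int[of "-1"] by (intro small) auto
    with 3 y z have "x = 1" by auto
    \<comment> \<open>With \<open>x = 1\<close>, the translate by -2 has a norm strictly between -1
      and 0.\<close>
    then have eq: "(x - 2) * (y - 2) * (z - 2) = - ((2 - y) * (2 - z))"
      by (simp add: algebra_simps)
    have "0 < (2 - y) * (2 - z)" "(2 - y) * (2 - z) < 1"
      using 3 y z by (intro prod; simp)+
    then show False
      using int[of "-2"] eq not_Ints_between[of "(x - 2) * (y - 2) * (z - 2)" "-1"] by simp
  next
    case 4
    \<comment> \<open>The reflection \<open>u \<mapsto> 2 - u\<close> reduces \<open>b = -3\<close>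
      to the case of trace zero.\<close>
    have "(2 - x) * (2 - y) * (2 - z) = - ((x - 2) * (y - 2) * (z - 2))"
      "(2 - x + 1) * (2 - y + 1) * (2 - z + 1) = - ((x - 3) * (y - 3) * (z - 3))"
      by (simp_all add: algebra_simps)
    then have "(2 - x) * (2 - y) * (2 - z) \<in> \<int>" "(2 - x + 1) * (2 - y + 1) * (2 - z + 1) \<in> \<int>"
      using int[of "-2"] int[of "-3"] by simp_all
    with 4 y z sum show False
      by (intro no_trace_zero_unit[of "2 - y" "2 - z" "2 - x"]) auto
  qed
qed

section \<open>The intervals for the quadratic element\<close>

text \<open>The conditions \<open>c < upper b n\<close> and \<open>lower b n < c\<close> express
  that \<open>x^2 + n * x + (c + n^2 - b * n)\<close> is negative at 0 and positive at 1.\<close>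

definition upper :: "int \<Rightarrow> int \<Rightarrow> int" where "upper b n = - n\<^sup>2 + b * n"

definition lower :: "int \<Rightarrow> int \<Rightarrow> int" where "lower b n = - n\<^sup>2 + (b - 1) * n - 1"

lemma lower_less_upper: "0 \<le> k \<Longrightarrow> lower b k < upper b k"
  by (simp add: lower_def upper_def algebra_simps)

text \<open>The right side exceeds the left by \<open>k - b\<close>. So \<open>upper\<close> cuts
  the nonpositive integers into blocks, and \<open>lower\<close> splits each block at most
  once.\<close>

lemma upper_Suc_le_lower: "b \<le> 0 \<Longrightarrow> 0 \<le> k \<Longrightarrow> upper b (k + 1) \<le> lower b k"
  by (simp add: lower_def upper_def algebra_simps power2_eq_square)

lemma upper_antimono:
  assumes "b \<le> 0" "0 \<le> k" "k \<le> l"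
  shows "upper b l \<le> upper b k"
proof -
  have "0 \<le> (l - k) * (l + k - b)"
    using assms by simp
  then show ?thesis
    by (simp add: upper_def algebra_simps power2_eq_square)
qed

lemma upper_interval_unique:
  assumes "b \<le> 0" "0 \<le> k" "0 \<le> l"
    and "upper b (k + 1) < c" "c \<le> upper b k" "upper b (l + 1) < c" "c \<le> upper b l"
  shows "k = l"
proof (rule ccontr)
  assume "k \<noteq> l"
  then consider "k + 1 \<le> l" | "l + 1 \<le> k" by linarith
  then show False
    using assms upper_antimono[of b "k + 1" l] upper_antimono[of b "l + 1" k] by cases linarith+
qed

text \<open>Since \<open>upper b\<close> starts at 0 and eventually drops below \<open>c\<close>,
  the index just before it first does so serves as \<open>k\<close>.\<close>

lemma upper_interval_exists:
  assumes "c \<le> 0"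
  obtains k where "0 \<le> k" "upper b (k + 1) < c" "c \<le> upper b k"
proof -
  have "upper b (int m) < c" if "\<bar>b\<bar> + \<bar>c\<bar> < int m" for m
  proof -
    have "int m * (int m - b) \<ge> int m * 1"
      using that by (intro mult_left_mono) auto
    then show ?thesis
      using that by (simp add: upper_def algebra_simps power2_eq_square)
  qed
  from this[of "nat (\<bar>b\<bar> + \<bar>c\<bar> + 1)"] have ex: "\<exists>m. upper b (int m) < c"
    by (intro exI[of _ "nat (\<bar>b\<bar> + \<bar>c\<bar> + 1)"]) simp
  define m where "m = (LEAST m. upper b (int m) < c)"
  have m: "upper b (int m) < c" unfolding m_def using ex by (rule LeastI_ex)
  have "m \<noteq> 0" using m assms by (auto simp: upper_def intro!: Nat.gr0I)
  then obtain l where l: "m = Suc l" by (cases m) auto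
  have "\<not> upper b (int l) < c"
    using not_less_Least[of l "\<lambda>m. upper b (int m) < c"] l unfolding m_def by simp
  with m l show thesis
    by (intro that[of "int l"]) (auto simp: add.commute)
qed

text \<open>The substitution \<open>n = b - 1 - k\<close> turns the intervals for negative \<open>n\<close> into the gaps
  between the intervals for nonnegative \<open>n\<close>.\<close>

lemma quadratic_range_iff:
  assumes "-3 \<le> b" "b \<le> 0"
  shows "quadratic_range b c n \<longleftrightarrow>
    (1 + epsilon b \<le> n \<and> lower b n < c \<and> c < upper b n) \<or>
    (2 + b + epsilon (- 3 - b) \<le> b - 1 - n \<and>
      upper b (b - 1 - n + 1) < c \<and> c < lower b (b - 1 - n))"
proof -
  have "upper b (b - 1 - n + 1) = - n\<^sup>2 + b * n"
    "lower b (b - 1 - n) = - n\<^sup>2 + (b - 1) * n - 1"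
    by (simp_all add: upper_def lower_def algebra_simps power2_eq_square)
  then show ?thesis
    by (auto simp: quadratic_range_def upper_def lower_def)
qed

text \<open>The block containing \<open>c\<close> determines \<open>k\<close>, and the side of
  \<open>lower b k\<close> on which \<open>c\<close> lies tells which of the two formulas produced
  \<open>k\<close>; hence \<open>n\<close> can be recovered from \<open>c\<close>.\<close>

lemma quadratic_range_interval:
  assumes b: "-3 \<le> b" "b \<le> 0" and n: "quadratic_range b c n"
  defines "k \<equiv> if n \<ge> 1 then n else b - 1 - n"
  shows "0 \<le> k" "upper b (k + 1) < c" "c < upper b k" "c \<noteq> lower b k" "n \<ge> 1 \<longleftrightarrow> lower b k < c"
proof -
  have eps: "0 \<le> epsilon b" "0 \<le> 2 + b + epsilon (- 3 - b)"
    using b by (auto simp: epsilon_def)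
  from n have "0 \<le> k \<and> upper b (k + 1) < c \<and> c < upper b k \<and> c \<noteq> lower b k \<and>
      (n \<ge> 1 \<longleftrightarrow> lower b k < c)"
    unfolding quadratic_range_iff[OF b]
  proof (elim disjE conjE)
    assume *: "1 + epsilon b \<le> n" "lower b n < c" "c < upper b n"
    with eps have "k = n" "n \<ge> 1" by (auto simp: k_def)
    with * upper_Suc_le_lower[of b n] b show ?thesis by auto
  next
    assume *: "2 + b + epsilon (- 3 - b) \<le> b - 1 - n" "upper b (b - 1 - n + 1) < c"
      "c < lower b (b - 1 - n)"
    with eps b have k: "k = b - 1 - n" "\<not> n \<ge> 1" "0 \<le> k" by (auto simp: k_def)
    then show ?thesis
      using * lower_less_upper[of k b] unfolding k(1)[symmetric] by auto
  qed
  then show "0 \<le> k" "upper b (k + 1) < c" "c < upper b k" "c \<noteq> lower b k" "n \<ge> 1 \<longleftrightarrow> lower b k < c"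
    by auto
qed

lemma quadratic_range_unique:
  assumes b: "-3 \<le> b" "b \<le> 0" and "quadratic_range b c n" "quadratic_range b c n'"
  shows "n = n'"
proof -
  note n = quadratic_range_interval[OF b assms(3)] and n' = quadratic_range_interval[OF b assms(4)]
  have "(if n \<ge> 1 then n else b - 1 - n) = (if n' \<ge> 1 then n' else b - 1 - n')"
    using b n(1-3) n'(1-3) by (intro upper_interval_unique[of b _ _ c]) linarith+
  with n(5) n'(5) show ?thesis
    by (auto split: if_splits)
qed

lemma all_cubic_form_iff:
  "all_cubic_form b c \<longleftrightarrow>
    (\<exists>n. n \<ge> delta b \<and> c = lower b n) \<or> (\<exists>n. n \<ge> 1 + epsilon b - epsilon (- 3 - b) \<and> c = upper b n)"
  by (simp add: all_cubic_form_def lower_def upper_def)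

text \<open>The special values of \<open>c\<close> are end points of the open intervals, and by
  interlacing they fall into no other interval.\<close>

lemma not_quadratic_range_if_all_cubic_form:
  assumes b: "-3 \<le> b" "b \<le> 0" and "all_cubic_form b c"
  shows "\<not> quadratic_range b c n"
proof
  assume n: "quadratic_range b c n"
  define k where "k = (if n \<ge> 1 then n else b - 1 - n)"
  note k = quadratic_range_interval[OF b n, folded k_def]
  from assms(3) obtain l where l: "0 \<le> l" "c = lower b l \<or> c = upper b l"
  proof -
    have nonneg: "0 \<le> delta b" "0 \<le> 1 + epsilon b - epsilon (- 3 - b)"
      by (auto simp: delta_def epsilon_def)
    from assms(3) consider n where "delta b \<le> n" "c = lower b n"
      | n where "1 + epsilon b - epsilon (- 3 - b) \<le> n" "c = upper b n"
      unfolding all_cubic_form_iff by blast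
    then show thesis
    proof cases
      case 1
      with nonneg that[of n] show thesis by simp
    next
      case 2
      with nonneg that[of n] show thesis by simp
    qed
  qed
  \<comment> \<open>For \<open>l = 0\<close> and \<open>b = 0\<close> the value
    \<open>lower b l\<close> equals \<open>upper b (l + 1)\<close> and belongs to the next
    block.\<close>
  with b have "upper b (l + 1) < c \<or> c = upper b (l + 1)" "c \<le> upper b l"
    using lower_less_upper[of l b] upper_Suc_le_lower[of b l] by auto
  then show False
  proof (elim disjE)
    assume "upper b (l + 1) < c"
    with k(1-3) l(1) b \<open>c \<le> upper b l\<close> have "k = l"
      by (intro upper_interval_unique[of b k l c]) auto
    with l(2) k show False by auto
  next
    assume c: "c = upper b (l + 1)"
    show False
      using c k(1-3) l(1) b upper_antimono[of b "l + 1" k] upper_antimono[of b "k + 1" "l + 1"]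
      by (cases "l + 1 \<le> k") auto
  qed
qed

text \<open>Within its block, \<open>c\<close> is the top point, the splitting point, or inside one
  of the two gaps; the upper bound on \<open>c\<close> rules out indices that are too small.\<close>

lemma quadratic_range_exists:
  assumes b: "-3 \<le> b" "b \<le> 0" and c: "c \<le> - b - 3" and "\<not> all_cubic_form b c"
  shows "\<exists>n. quadratic_range b c n"
proof -
  from b c have "c \<le> 0" by linarith
  then obtain k where k: "0 \<le> k" "upper b (k + 1) < c" "c \<le> upper b k"
    by (rule upper_interval_exists)
  have b_cases: "b = 0 \<or> b = -1 \<or> b = -2 \<or> b = -3" using b by linarith
  \<comment> \<open>Every required lower bound on the index is at most 2, so a violation leaves
    \<open>k = 0\<close> or \<open>k = 1\<close>, to be checked for each \<open>b\<close>.\<close>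
  have bounds: "1 + epsilon b - epsilon (- 3 - b) \<le> 2" "delta b \<le> 2" "1 + epsilon b \<le> 2"
    "2 + b + epsilon (- 3 - b) \<le> 2"
    using b by (auto simp: epsilon_def delta_def)
  from k(3) consider "c = upper b k" | "c = lower b k" | "lower b k < c" "c < upper b k" | "c < lower b k"
    by linarith
  then show ?thesis
  proof cases
    case 1
    have "1 + epsilon b - epsilon (- 3 - b) \<le> k"
    proof (rule ccontr)
      assume less: "\<not> ?thesis"
      with bounds k(1) have "k = 0 \<or> k = 1" by linarith
      with b_cases 1 c less show False
        by (elim disjE) (simp_all add: upper_def epsilon_def)
    qed
    with 1 assms(4) show ?thesis by (auto simp: all_cubic_form_iff)
  next
    case 2
    have "delta b \<le> k"
    proof (rule ccontr)
      assume less: "\<not> ?thesis"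
      with bounds k(1) have "k = 0 \<or> k = 1" by linarith
      with b_cases 2 c less show False
        by (elim disjE) (simp_all add: lower_def delta_def)
    qed
    with 2 assms(4) show ?thesis by (auto simp: all_cubic_form_iff)
  next
    case 3
    have "1 + epsilon b \<le> k"
    proof (rule ccontr)
      assume less: "\<not> ?thesis"
      with bounds k(1) have "k = 0 \<or> k = 1" by linarith
      with b_cases 3 c less show False
        by (elim disjE) (simp_all add: lower_def upper_def epsilon_def)
    qed
    with 3 show ?thesis using quadratic_range_iff[OF b] by blast
  next
    case 4
    have "2 + b + epsilon (- 3 - b) \<le> k"
    proof (rule ccontr)
      assume less: "\<not> ?thesis"
      with bounds k(1) have "k = 0 \<or> k = 1" by linarith
      with b_cases 4 k(2) c less show False
        by (elim disjE) (simp_all add: lower_def upper_def epsilon_def)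
    qed
    with 4 k(2) show ?thesis
      by (intro exI[of _ "b - 1 - k"]) (simp add: quadratic_range_iff[OF b])
  qed
qed

section \<open>Cubic and quadratic elements\<close>

definition cubic :: "int \<Rightarrow> int \<Rightarrow> int \<Rightarrow> rat poly" where
  "cubic b c d = [:of_int d, of_int c, of_int b, 1:]"

lemma rpoly_cubic: "rpoly (cubic b c d) x = x ^ 3 + of_int b * x\<^sup>2 + of_int c * x + of_int d"
  by (simp add: cubic_def map_poly_pCons algebra_simps power2_eq_square power3_eq_cube)

lemma cubic_rational_root_int:
  assumes "poly (cubic b c d) r = 0"
  shows "r \<in> \<int>"
proof (rule rational_algebraic_int_is_int)
  show "algebraic_int r"
  proof (rule algebraic_int.intros[OF _ _ assms])
    show "lead_coeff (cubic b c d) = 1" by (simp add: cubic_def)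
    show "\<forall>i. coeff (cubic b c d) i \<in> \<int>"
      by (simp add: cubic_def coeff_pCons split: nat.split)
  qed
  show "r \<in> \<rat>"
    by (cases r) (simp add: Fract_of_int_quotient)
qed

text \<open>An algebraic integer strictly between 0 and 1 is not an integer, hence irrational, and a
  quadratic with an irrational root is irreducible.\<close>

lemma rat_min_poly_quadratic:
  fixes \<alpha> :: real and e n :: int
  assumes \<alpha>: "0 < \<alpha>" "\<alpha> < 1" and root: "\<alpha>\<^sup>2 + of_int n * \<alpha> + of_int e = 0"
  shows "irreducible ([: of_int e, of_int n, 1 :] :: rat poly)"
    and "rat_min_poly (of_real \<alpha>) = [: of_int e, of_int n, 1 :]"
    and "real_quadratic (of_real \<alpha>)"
proof -
  let ?q = "[: of_int e, of_int n, 1 :] :: rat poly"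
  have "algebraic_int \<alpha>"
  proof (rule algebraic_int.intros)
    show "lead_coeff [: of_int e, of_int n, 1 :: real :] = 1" by simp
    show "\<forall>i. coeff [: of_int e, of_int n, 1 :: real :] i \<in> \<int>"
      by (simp add: coeff_pCons split: nat.split)
    show "poly [: of_int e, of_int n, 1 :] \<alpha> = 0"
      using root by (simp add: algebra_simps power2_eq_square)
  qed
  then have "\<alpha> \<notin> \<rat>"
    using \<alpha> not_Ints_between[of \<alpha> 0] by (auto dest: rational_algebraic_int_is_int)
  moreover have q: "rpoly ?q \<alpha> = 0"
    using root by (simp add: map_poly_pCons algebra_simps power2_eq_square)
  ultimately show irr: "irreducible ?q"
    by (intro irreducible_quadratic) simp_all
  have "rpoly ?q (of_real \<alpha> :: complex) = 0"
    unfolding rpoly_of_real q by simp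
  from rat_min_poly_eq[OF _ irr this]
  show "rat_min_poly (of_real \<alpha>) = ?q" and "real_quadratic (of_real \<alpha>)"
    by (simp_all add: real_quadratic_def)
qed

lemma totally_real_cubic_if_irreducible:
  fixes \<alpha> \<rho> \<sigma> :: real
  assumes irr: "irreducible (cubic b c d)"
    and roots: "\<alpha> + \<rho> + \<sigma> = of_int (- b)" "\<alpha> * \<rho> + \<alpha> * \<sigma> + \<rho> * \<sigma> = of_int c"
      "\<alpha> * \<rho> * \<sigma> = of_int (- d)"
  shows "totally_real_cubic (of_real \<alpha>)"
proof -
  have "\<alpha> + \<rho> + \<sigma> = - of_int b" "\<alpha> * \<rho> * \<sigma> = - of_int d"
    using roots by simp_all
  \<comment> \<open>The symmetric functions are transported to the complex numbers, so that the
    factorisation there shows all conjugates to be real.\<close>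
  note roots' = arg_cong[OF this(1), of complex_of_real]
    arg_cong[OF roots(2), of complex_of_real] arg_cong[OF this(2), of complex_of_real]
  have factor: "rpoly (cubic b c d) w = (w - of_real \<alpha>) * (w - of_real \<rho>) * (w - of_real \<sigma>)"
    for w :: complex
    unfolding rpoly_cubic using roots' by (intro cubic_from_symmetric_functions) simp_all
  have "lead_coeff (cubic b c d) = 1" by (simp add: cubic_def)
  moreover have "rpoly (cubic b c d) (complex_of_real \<alpha>) = 0" by (simp add: factor)
  ultimately have "rat_min_poly (of_real \<alpha>) = cubic b c d" "algebraic (complex_of_real \<alpha>)"
    using irr by (blast intro: rat_min_poly_eq)+
  moreover have "degree (cubic b c d) = 3" by (simp add: cubic_def)
  ultimately show ?thesis
    unfolding totally_real_cubic_def rat_conjugates_def by (auto simp: factor)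
qed

text \<open>A reducible monic integral cubic has an integer root \<open>r\<close>; its quadratic
  cofactor vanishes at \<open>\<alpha>\<close>, and the signs of the cubic at 0 and 1 determine
  those of the cofactor.\<close>

lemma I3tr_cubic_or_quadratic:
  assumes \<alpha>: "\<alpha> \<in> I3tr b c"
  obtains (cubic) d :: int and \<rho> \<sigma> :: real
    where "irreducible (cubic b c d)" "1 < \<rho>" "\<sigma> < 0"
      and "\<alpha> + \<rho> + \<sigma> = of_int (- b)" "\<alpha> * \<rho> + \<alpha> * \<sigma> + \<rho> * \<sigma> = of_int c" "\<alpha> * \<rho> * \<sigma> = of_int (- d)"
  | (quadratic) n
    where "quadratic_range b c n" "\<alpha>\<^sup>2 + of_int n * \<alpha> + of_int (c + n\<^sup>2 - b * n) = 0"
proof -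
  from \<alpha> obtain d \<rho> \<sigma>
    where bounds: "0 < \<alpha>" "\<alpha> < 1" "1 < \<rho>" "\<sigma> < 0" and d: "1 \<le> d" "d \<le> - b - c - 2"
    and roots: "\<alpha> + \<rho> + \<sigma> = of_int (- b)" "\<alpha> * \<rho> + \<alpha> * \<sigma> + \<rho> * \<sigma> = of_int c"
      "\<alpha> * \<rho> * \<sigma> = of_int (- d)"
    by (rule I3tr_roots)
  show thesis
  proof (cases "\<exists>r. poly (cubic b c d) r = 0")
    case False
    then have "irreducible (cubic b c d)"
      by (intro irreducible_cubic) (auto simp: cubic_def)
    then show thesis
      using cubic bounds(3,4) roots by blast
  next
    case True
    then obtain r' where r': "poly (cubic b c d) r' = 0" by blast
    then obtain r where "r' = of_int r"
      using cubic_rational_root_int by (metis Ints_cases)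
    with r' have "(of_int (r ^ 3 + b * r\<^sup>2 + c * r + d) :: rat) = 0"
      by (simp add: cubic_def algebra_simps power2_eq_square power3_eq_cube)
    then have r: "r ^ 3 + b * r\<^sup>2 + c * r + d = 0"
      by (simp only: of_int_eq_0_iff)
    \<comment> \<open>Dividing the cubic by \<open>x - r\<close> gives
      \<open>x^2 + n * x + e\<close>.\<close>
    define n where "n = r + b"
    define e where "e = c + n\<^sup>2 - b * n"
    have d_eq: "d = - r * e" and "1 + b + c + d = (1 - r) * (1 + n + e)"
      using r by (simp_all add: n_def e_def algebra_simps power2_eq_square power3_eq_cube)
    then have sign0: "r * e < 0" and sign1: "(1 - r) * (1 + n + e) < 0"
      using d by simp_all
    have "\<alpha> ^ 3 + of_int b * \<alpha>\<^sup>2 + of_int c * \<alpha> + of_int d = 0"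
      using cubic_from_symmetric_functions[of \<alpha> \<rho> \<sigma> "of_int b" "of_int c" "of_int d" \<alpha>] roots by simp
    moreover have "\<alpha> ^ 3 + of_int b * \<alpha>\<^sup>2 + of_int c * \<alpha> + of_int d =
        (\<alpha> - of_int r) * (\<alpha>\<^sup>2 + of_int n * \<alpha> + of_int e)"
      unfolding d_eq by (simp add: n_def e_def algebra_simps power2_eq_square power3_eq_cube)
    moreover have "\<alpha> \<noteq> of_int r"
      using bounds(1,2) by auto
    ultimately have root: "\<alpha>\<^sup>2 + of_int n * \<alpha> + of_int e = 0" by simp
    have "quadratic_range b c n"
    proof (cases "r > 0")
      case True
      with sign0 have "e < 0" by (simp add: mult_less_0_iff)
      have "r \<noteq> 1" using sign1 by auto
      with True sign1 have "0 < 1 + n + e" by (simp add: mult_less_0_iff)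
      \<comment> \<open>Integrality gives \<open>e \<le> -1\<close> and
        \<open>1 + n + e \<ge> 1\<close>, so \<open>n \<ge> 1\<close>; for \<open>b = 0\<close> one
        has \<open>n = r \<ge> 2\<close>, which accounts for \<open>epsilon\<close>.\<close>
      moreover have "1 + epsilon b \<le> n"
        using \<open>e < 0\<close> \<open>0 < 1 + n + e\<close> \<open>r \<noteq> 1\<close> True by (auto simp: epsilon_def n_def)
      ultimately show ?thesis
        using \<open>e < 0\<close> unfolding quadratic_range_def e_def by (simp add: algebra_simps)
    next
      case False
      with sign0 have "r < 0" "0 < e" by (simp_all add: mult_less_0_iff)
      with sign1 have "1 + n + e < 0" by (simp add: mult_less_0_iff)
      \<comment> \<open>Similarly \<open>n \<le> -3\<close>; for \<open>b = -3\<close> the bound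
        improves by one, since \<open>n = r - 3\<close> with \<open>r < 0\<close>.\<close>
      moreover have "n \<le> - 3 - epsilon (- 3 - b)"
        using \<open>0 < e\<close> \<open>1 + n + e < 0\<close> \<open>r < 0\<close> by (auto simp: epsilon_def n_def)
      ultimately show ?thesis
        using \<open>0 < e\<close> unfolding quadratic_range_def e_def by (simp add: algebra_simps)
    qed
    then show thesis using root unfolding e_def by (rule quadratic)
  qed
qed

text \<open>The sign change of the quadratic between 0 and 1 yields \<open>\<alpha>\<close>;
  multiplying by \<open>x - (n - b)\<close> gives the cubic, whose constant term is in range because
  of the signs.\<close>

lemma quadratic_range_root:
  assumes b: "-3 \<le> b" "b \<le> 0" and n: "quadratic_range b c n"
  obtains \<alpha> where "\<alpha> \<in> I3tr b c" "\<alpha>\<^sup>2 + of_int n * \<alpha> + of_int (c + n\<^sup>2 - b * n) = 0"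
proof -
  define r e where "r = n - b" and "e = c + n\<^sup>2 - b * n"
  define q :: "real poly" where "q = [:of_int e, of_int n, 1:]"
  have n_cases: "(n \<ge> 1 + epsilon b \<and> e < 0 \<and> 0 < 1 + n + e) \<or>
      (n \<le> - 3 - epsilon (- 3 - b) \<and> 0 < e \<and> 1 + n + e < 0)"
    using n unfolding quadratic_range_def e_def by (auto simp: algebra_simps)
  have q01: "poly q 0 = of_int e" "poly q 1 = of_int (1 + n + e)" by (simp_all add: q_def)
  have d: "1 \<le> - r * e" "(1 - r) * (1 + n + e) \<le> -1"
    and sign: "poly q 0 * poly q 1 < 0"
  proof -
    \<comment> \<open>The \<open>epsilon\<close> terms keep the integer root \<open>r\<close> away
      from 0 and 1.\<close>
    from n_cases have "0 < - r * e \<and> (1 - r) * (1 + n + e) < 0 \<and> e * (1 + n + e) < 0"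
    proof (elim disjE conjE)
      assume *: "n \<ge> 1 + epsilon b" "e < 0" "0 < 1 + n + e"
      then have "1 < r" using b by (auto simp: r_def epsilon_def split: if_splits)
      with * show ?thesis by (simp add: mult_less_0_iff)
    next
      assume *: "n \<le> - 3 - epsilon (- 3 - b)" "0 < e" "1 + n + e < 0"
      then have "r < 0" using b by (auto simp: r_def epsilon_def split: if_splits)
      with * show ?thesis by (simp add: mult_less_0_iff)
    qed
    then show "1 \<le> - r * e" "(1 - r) * (1 + n + e) \<le> -1" "poly q 0 * poly q 1 < 0"
      unfolding q01 of_int_mult[symmetric] of_int_less_0_iff by auto
  qed
  obtain \<alpha> where \<alpha>: "0 < \<alpha>" "\<alpha> < 1" "poly q \<alpha> = 0"
    using poly_IVT[OF zero_less_one sign] by blast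
  then have root: "\<alpha>\<^sup>2 + of_int n * \<alpha> + of_int e = 0"
    by (simp add: q_def algebra_simps power2_eq_square)
  have "\<alpha> ^ 3 + of_int b * \<alpha>\<^sup>2 + of_int c * \<alpha> + of_int (- r * e) =
      (\<alpha> - of_int r) * (\<alpha>\<^sup>2 + of_int n * \<alpha> + of_int e)"
    by (simp add: r_def e_def algebra_simps power2_eq_square power3_eq_cube)
  moreover have "- r * e \<le> - b - c - 2"
    using d(2) by (simp add: r_def e_def algebra_simps power2_eq_square power3_eq_cube)
  ultimately have "\<alpha> \<in> I3tr b c"
    unfolding I3tr_def using \<alpha> d(1) root by (auto intro!: exI[of _ "- r * e"])
  then show thesis using root unfolding e_def by (rule that)
qed

text \<open>Two distinct roots in the unit interval would have sum \<open>- n\<close>, forcing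
  \<open>n = -1\<close>, which no range allows.\<close>

lemma quadratic_range_root_unique:
  fixes \<alpha> \<beta> e :: real
  assumes b: "-3 \<le> b" "b \<le> 0" and n: "quadratic_range b c n"
    and \<alpha>: "0 < \<alpha>" "\<alpha> < 1" "\<alpha>\<^sup>2 + of_int n * \<alpha> + e = 0"
    and \<beta>: "0 < \<beta>" "\<beta> < 1" "\<beta>\<^sup>2 + of_int n * \<beta> + e = 0"
  shows "\<alpha> = \<beta>"
proof (rule ccontr)
  assume "\<alpha> \<noteq> \<beta>"
  moreover have "(\<alpha> - \<beta>) * (\<alpha> + \<beta> + of_int n) = 0"
    using \<alpha>(3) \<beta>(3) by (simp add: algebra_simps power2_eq_square)
  ultimately have "of_int n = - (\<alpha> + \<beta>)" by simp
  with \<alpha> \<beta> have "- 2 < n" "n < 0" by linarith+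
  moreover have "0 \<le> epsilon b" "0 \<le> epsilon (- 3 - b)"
    by (simp_all add: epsilon_def)
  moreover have "1 + epsilon b \<le> n \<or> n \<le> - 3 - epsilon (- 3 - b)"
    using n unfolding quadratic_range_def by blast
  ultimately show False by linarith
qed

section \<open>Comparison of the generated fields\<close>

text \<open>Equal fields make \<open>\<alpha>\<close> and \<open>\<beta>\<close> polynomials in each
  other. By irreducibility of \<open>p\<close> these relations pass to every root of
  \<open>p\<close>, so \<open>g\<close> maps the real roots of \<open>p\<close> injectively to roots
  of \<open>q\<close>; reducing \<open>g\<close> modulo \<open>p\<close> bounds its degree.\<close>

lemma rat_adjoin_eq_conjugation:
  fixes \<alpha> \<beta> :: real
  assumes p: "irreducible p" "rpoly p \<alpha> = 0" and q: "irreducible q" "rpoly q \<beta> = 0"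
    and eq: "rat_adjoin (of_real \<alpha>) = rat_adjoin (of_real \<beta>)"
  obtains g h where "\<beta> = rpoly g \<alpha>" "g = 0 \<or> degree g < degree p"
    "\<And>\<xi> :: real. rpoly p \<xi> = 0 \<Longrightarrow> rpoly q (rpoly g \<xi>) = 0"
    "\<And>\<xi> :: real. rpoly p \<xi> = 0 \<Longrightarrow> rpoly h (rpoly g \<xi>) = \<xi>"
proof -
  have pq: "rpoly p (complex_of_real \<alpha>) = 0" "rpoly q (complex_of_real \<beta>) = 0"
    using p q by (simp_all add: rpoly_of_real)
  obtain g' where "of_real \<beta> = rpoly g' (complex_of_real \<alpha>)"
    using rat_adjoin_irreducible_root[OF p(1) pq(1)] rat_adjoin_generator eq by metis
  then have g': "\<beta> = rpoly g' \<alpha>" by (simp add: rpoly_of_real)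
  obtain h where "of_real \<alpha> = rpoly h (complex_of_real \<beta>)"
    using rat_adjoin_irreducible_root[OF q(1) pq(2)] rat_adjoin_generator eq by metis
  then have h: "\<alpha> = rpoly h \<beta>" by (simp add: rpoly_of_real)
  define g where "g = g' mod p"
  have mod: "rpoly g' \<xi> = rpoly g \<xi>" if "rpoly p \<xi> = 0" for \<xi> :: real
    using that rpoly_add[of "g' div p * p" g \<xi>] by (simp add: g_def rpoly_mult)
  with p(2) g' have g: "\<beta> = rpoly g \<alpha>" by simp
  have "p dvd pcompose q g"
    by (rule irreducible_dvd_if_common_root[OF p]) (simp add: rpoly_pcompose q(2) flip: g)
  moreover have "p dvd pcompose h g - [:0, 1:]"
    by (rule irreducible_dvd_if_common_root[OF p])
      (simp add: rpoly_diff rpoly_pcompose map_poly_pCons flip: g h)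
  ultimately obtain u v where uv: "pcompose q g = p * u" "pcompose h g - [:0, 1:] = p * v"
    by (auto elim!: dvdE)
  show thesis
  proof (rule that[OF g])
    show "g = 0 \<or> degree g < degree p"
      unfolding g_def using p(1) by (intro degree_mod_less) auto
    fix \<xi> :: real assume \<xi>: "rpoly p \<xi> = 0"
    then have "rpoly (pcompose q g) \<xi> = 0" "rpoly (pcompose h g - [:0, 1:]) \<xi> = 0"
      unfolding uv by (simp_all add: rpoly_mult)
    then show "rpoly q (rpoly g \<xi>) = 0" "rpoly h (rpoly g \<xi>) = \<xi>"
      by (simp_all add: rpoly_diff rpoly_pcompose map_poly_pCons)
  qed
qed

lemma rpoly_cubic_factor:
  fixes x \<alpha> \<rho> \<sigma> :: real
  assumes "\<alpha> + \<rho> + \<sigma> = of_int (- b)" "\<alpha> * \<rho> + \<alpha> * \<sigma> + \<rho> * \<sigma> = of_int c" "\<alpha> * \<rho> * \<sigma> = of_int (- d)"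
  shows "rpoly (cubic b c d) x = (x - \<alpha>) * (x - \<rho>) * (x - \<sigma>)"
  unfolding rpoly_cubic using assms by (intro cubic_from_symmetric_functions) simp_all

lemma cubic_adjoin_neq:
  fixes \<alpha> \<rho> \<sigma> \<beta> \<rho>' \<sigma>' :: real
  assumes b: "-3 \<le> b" "b \<le> 0"
    and irr: "irreducible (cubic b c d)" and bounds: "0 < \<alpha>" "1 < \<rho>" "\<sigma> < 0"
    and roots: "\<alpha> + \<rho> + \<sigma> = of_int (- b)" "\<alpha> * \<rho> + \<alpha> * \<sigma> + \<rho> * \<sigma> = of_int c"
      "\<alpha> * \<rho> * \<sigma> = of_int (- d)"
    and irr': "irreducible (cubic b c d')" and bounds': "\<beta> < 1" "1 < \<rho>'" "\<sigma>' < 0"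
    and roots': "\<beta> + \<rho>' + \<sigma>' = of_int (- b)" "\<beta> * \<rho>' + \<beta> * \<sigma>' + \<rho>' * \<sigma>' = of_int c"
      "\<beta> * \<rho>' * \<sigma>' = of_int (- d')"
    and less: "\<alpha> < \<beta>"
  shows "rat_adjoin (of_real \<alpha>) \<noteq> rat_adjoin (of_real \<beta>)"
proof
  assume eq: "rat_adjoin (of_real \<alpha>) = rat_adjoin (of_real \<beta>)"
  note factor = rpoly_cubic_factor[OF roots] and factor' = rpoly_cubic_factor[OF roots']
  have "rpoly (cubic b c d) \<alpha> = 0" "rpoly (cubic b c d') \<beta> = 0"
    by (simp_all add: factor factor')
  then obtain g h where g: "\<beta> = rpoly g \<alpha>" "g = 0 \<or> degree g < degree (cubic b c d)"
    and conj: "\<And>\<xi> :: real. rpoly (cubic b c d) \<xi> = 0 \<Longrightarrow> rpoly (cubic b c d') (rpoly g \<xi>) = 0"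
    and inv: "\<And>\<xi> :: real. rpoly (cubic b c d) \<xi> = 0 \<Longrightarrow> rpoly h (rpoly g \<xi>) = \<xi>"
    using rat_adjoin_eq_conjugation[OF irr _ irr' _ eq] by metis
  define G :: "real \<Rightarrow> real" where "G = rpoly g"
  \<comment> \<open>Degree at most two is the form of \<open>g\<close> in which the integrality of
    norms is available.\<close>
  have "degree g < 3" using g(2) by (auto simp: cubic_def)
  then have "coeff g i = coeff [:coeff g 0, coeff g 1, coeff g 2:] i" for i
    by (auto simp: coeff_pCons numeral_2_eq_2 intro!: coeff_eq_0 split: nat.split)
  then have "g = [:coeff g 0, coeff g 1, coeff g 2:]" by (rule poly_eqI)
  then obtain u v w where "g = [:u, v, w:]" by blast
  then have G: "G x = of_rat u + of_rat v * x + of_rat w * x\<^sup>2" for x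
    by (simp add: G_def map_poly_pCons algebra_simps power2_eq_square)
  have root: "rpoly (cubic b c d') (G \<xi>) = 0" and inv: "rpoly h (G \<xi>) = \<xi>"
    if "\<xi> \<in> {\<alpha>, \<rho>, \<sigma>}" for \<xi>
    using that conj[of \<xi>] inv[of \<xi>] by (auto simp: G_def factor)
  have norm: "(G \<alpha> + of_int s * \<alpha> + of_int t) * (G \<rho> + of_int s * \<rho> + of_int t) *
      (G \<sigma> + of_int s * \<sigma> + of_int t) \<in> \<int>" for s t
    using root by (intro norm_in_Ints[OF roots G, of b c d']) (simp add: rpoly_cubic)
  have G\<alpha>: "G \<alpha> = \<beta>" using g(1) by (simp add: G_def)
  have "G \<rho> \<in> {\<beta>, \<rho>', \<sigma>'}" "G \<sigma> \<in> {\<beta>, \<rho>', \<sigma>'}"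
    using root[of \<rho>] root[of \<sigma>] by (auto simp: factor')
  \<comment> \<open>The left inverse \<open>h\<close> makes \<open>G\<close> injective on the roots,
    so only two bijections remain.\<close>
  moreover have "G \<rho> \<noteq> \<beta>" "G \<sigma> \<noteq> \<beta>" "G \<rho> \<noteq> G \<sigma>"
    using inv[of \<alpha>] inv[of \<rho>] inv[of \<sigma>] bounds bounds'(1) less G\<alpha> by auto
  ultimately consider "G \<rho> = \<rho>'" "G \<sigma> = \<sigma>'" | "G \<rho> = \<sigma>'" "G \<sigma> = \<rho>'" by auto
  moreover have anti: "\<rho>' < \<rho>" "\<sigma>' < \<sigma>"
    using roots_antimono[OF bounds(1) bounds'(1) bounds(2,3) bounds'(2,3) less] roots roots' by simp_all
  ultimately show False
  proof cases
    case 1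
    define x y where "x = \<rho> - \<rho>'" and "y = \<sigma> - \<sigma>'"
    have xy: "0 < x" "0 < y" "\<beta> - \<alpha> = x + y" "x + y < 1"
      using anti roots(1) roots'(1) bounds(1) bounds'(1) by (auto simp: x_def y_def)
    \<comment> \<open>For \<open>s = -1\<close> and \<open>t = 0\<close> this is the norm of
      \<open>\<beta> - \<alpha>\<close>.\<close>
    have "(\<beta> - \<alpha>) * (\<rho>' - \<rho>) * (\<sigma>' - \<sigma>) \<in> \<int>"
      using norm[of "-1" 0] 1 G\<alpha> by simp
    then have "(x + y) * (x * y) \<in> \<int>"
      unfolding xy(3)[symmetric] by (simp add: x_def y_def algebra_simps)
    moreover have "x * y < 1 * 1"
      using xy by (intro mult_strict_mono) auto
    then have "(x + y) * (x * y) < 1 * 1"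
      using xy by (intro mult_strict_mono) auto
    ultimately show False
      using xy not_Ints_between[of "(x + y) * (x * y)" 0] by simp
  next
    case 2
    show False
    \<comment> \<open>For \<open>s = 1\<close> the norms are those of
      \<open>\<alpha> + \<beta> + t\<close>. By the monotonicity of the outer roots,
      \<open>\<sigma>' + \<rho>\<close> and \<open>\<rho>' + \<sigma>\<close> lie between
      \<open>\<rho>' + \<sigma>' = - b - \<beta>\<close> and
      \<open>\<rho> + \<sigma> = - b - \<alpha>\<close>.\<close>
    proof (rule swapped_norms_not_integral[OF b, of "\<beta> + \<alpha>" "\<sigma>' + \<rho>" "\<rho>' + \<sigma>"])
      show "(\<beta> + \<alpha> + of_int t) * (\<sigma>' + \<rho> + of_int t) * (\<rho>' + \<sigma> + of_int t) \<in> \<int>" for t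
        using norm[of 1 t] 2 G\<alpha> by simp
    qed (use anti roots(1) roots'(1) bounds bounds' less in auto)
  qed
qed

text \<open>The conjugation would map three distinct roots of the cubic injectively into the two
  roots of a quadratic.\<close>

lemma cubic_quadratic_adjoin_neq:
  fixes \<alpha> \<rho> \<sigma> \<beta> :: real
  assumes irr: "irreducible (cubic b c d)" and distinct: "\<alpha> \<noteq> \<rho>" "\<alpha> \<noteq> \<sigma>" "\<rho> \<noteq> \<sigma>"
    and roots: "\<alpha> + \<rho> + \<sigma> = of_int (- b)" "\<alpha> * \<rho> + \<alpha> * \<sigma> + \<rho> * \<sigma> = of_int c"
      "\<alpha> * \<rho> * \<sigma> = of_int (- d)"
    and \<beta>: "0 < \<beta>" "\<beta> < 1" "\<beta>\<^sup>2 + of_int n * \<beta> + of_int e = 0"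
  shows "rat_adjoin (of_real \<alpha>) \<noteq> rat_adjoin (of_real \<beta>)"
proof
  assume eq: "rat_adjoin (of_real \<alpha>) = rat_adjoin (of_real \<beta>)"
  note factor = rpoly_cubic_factor[OF roots]
  let ?q = "[: of_int e, of_int n, 1 :] :: rat poly"
  have e: "of_int e = - \<beta> * (\<beta> + of_int n)"
    using \<beta>(3) by (simp add: algebra_simps power2_eq_square)
  have q: "rpoly ?q x = (x - \<beta>) * (x + \<beta> + of_int n)" for x :: real
    by (simp add: map_poly_pCons e algebra_simps)
  have "rpoly (cubic b c d) \<alpha> = 0" "rpoly ?q \<beta> = 0"
    by (simp_all only: factor q) simp_all
  then obtain g h where
    "\<And>\<xi> :: real. rpoly (cubic b c d) \<xi> = 0 \<Longrightarrow> rpoly ?q (rpoly g \<xi>) = 0"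
    and inv: "\<And>\<xi> :: real. rpoly (cubic b c d) \<xi> = 0 \<Longrightarrow> rpoly h (rpoly g \<xi>) = \<xi>"
    using rat_adjoin_eq_conjugation[OF irr _ rat_min_poly_quadratic(1)[OF \<beta>] _ eq] by metis
  then have "\<xi> \<in> {\<alpha>, \<rho>, \<sigma>} \<Longrightarrow> rpoly g \<xi> = \<beta> \<or> rpoly g \<xi> = - \<beta> - of_int n" for \<xi>
    unfolding q factor by fastforce
  from this[of \<alpha>] this[of \<rho>] this[of \<sigma>] inv[of \<alpha>] inv[of \<rho>] inv[of \<sigma>] distinct show False
    by (auto simp: factor)
qed

text \<open>Two quadratic elements cannot occur: uniqueness of \<open>n\<close> would make them
  roots of the same quadratic in the unit interval, hence equal.\<close>

lemma I3tr_adjoin_neq_less: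
  assumes b: "-3 \<le> b" "b \<le> 0" and \<alpha>: "\<alpha> \<in> I3tr b c" and \<beta>: "\<beta> \<in> I3tr b c" and less: "\<alpha> < \<beta>"
  shows "rat_adjoin (of_real \<alpha>) \<noteq> rat_adjoin (of_real \<beta>)"
proof -
  have bounds: "0 < \<alpha>" "\<alpha> < 1" "0 < \<beta>" "\<beta> < 1" using \<alpha> \<beta> by (auto simp: I3tr_def)
  from \<alpha> show ?thesis
  proof (cases rule: I3tr_cubic_or_quadratic)
    case A: (cubic d \<rho> \<sigma>)
    from \<beta> show ?thesis
    proof (cases rule: I3tr_cubic_or_quadratic)
      case (cubic d' \<rho>' \<sigma>')
      with A b bounds less show ?thesis by (intro cubic_adjoin_neq)
    next
      case (quadratic n)
      show ?thesis
        by (rule cubic_quadratic_adjoin_neq[OF A(1) _ _ _ A(4-6) bounds(3,4) quadratic(2)])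
          (use A(2,3) bounds in auto)
    qed
  next
    case A: (quadratic n)
    from \<beta> show ?thesis
    proof (cases rule: I3tr_cubic_or_quadratic)
      case (cubic d' \<rho>' \<sigma>')
      show ?thesis
        by (rule cubic_quadratic_adjoin_neq[OF cubic(1) _ _ _ cubic(4-6) bounds(1,2) A(2), THEN not_sym])
          (use cubic(2,3) bounds in auto)
    next
      case (quadratic n')
      then have "n' = n" using A(1) quadratic_range_unique[OF b] by blast
      with A quadratic bounds less quadratic_range_root_unique[OF b A(1)] show ?thesis by blast
    qed
  qed
qed

section \<open>Degrees of the elements and conclusion\<close>

lemma I3tr_totally_real_cubic:
  assumes "\<alpha> \<in> I3tr b c" "\<And>n. quadratic_range b c n \<Longrightarrow>
    \<alpha>\<^sup>2 + of_int n * \<alpha> + of_int (c + n\<^sup>2 - b * n) \<noteq> 0"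
  shows "totally_real_cubic (of_real \<alpha>)"
  using assms(1)
proof (cases rule: I3tr_cubic_or_quadratic)
  case (cubic d \<rho> \<sigma>)
  then show ?thesis by (intro totally_real_cubic_if_irreducible)
next
  case (quadratic n)
  with assms(2) show ?thesis by blast
qed

text \<open>A further element that is not cubic would need an admissible \<open>n'\<close>, which
  must equal \<open>n\<close>, and would then be a second root of the same quadratic in the unit
  interval.\<close>

lemma I3tr_quadratic_element:
  assumes b: "-3 \<le> b" "b \<le> 0" and n: "quadratic_range b c n"
  obtains \<alpha> where "\<alpha> \<in> I3tr b c" "real_quadratic (of_real \<alpha>)"
    "\<alpha>\<^sup>2 + of_int n * \<alpha> + of_int (c + n\<^sup>2 - b * n) = 0"
    "\<And>\<beta>. \<beta> \<in> I3tr b c \<Longrightarrow> \<beta> \<noteq> \<alpha> \<Longrightarrow> totally_real_cubic (of_real \<beta>)"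
proof -
  obtain \<alpha> where \<alpha>: "\<alpha> \<in> I3tr b c" "\<alpha>\<^sup>2 + of_int n * \<alpha> + of_int (c + n\<^sup>2 - b * n) = 0"
    using quadratic_range_root[OF b n] by blast
  then have bounds: "0 < \<alpha>" "\<alpha> < 1" by (auto simp: I3tr_def)
  show thesis
  proof (rule that[OF \<alpha>(1) rat_min_poly_quadratic(3)[OF bounds \<alpha>(2)] \<alpha>(2)])
    fix \<beta> assume \<beta>: "\<beta> \<in> I3tr b c" "\<beta> \<noteq> \<alpha>"
    then have "0 < \<beta>" "\<beta> < 1" by (auto simp: I3tr_def)
    then have "\<beta>\<^sup>2 + of_int n' * \<beta> + of_int (c + n'\<^sup>2 - b * n') \<noteq> 0" if "quadratic_range b c n'" for n'
      using \<beta>(2) quadratic_range_unique[OF b that n] quadratic_range_root_unique[OF b n _ _ _ bounds \<alpha>(2)]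
      by blast
    with \<beta>(1) show "totally_real_cubic (of_real \<beta>)" by (rule I3tr_totally_real_cubic)
  qed
qed

theorem theorem14:
  fixes b c :: int
  assumes "-3 \<le> b" and "b \<le> 0" and "c \<le> - b - 3"
  shows
    "(\<forall>\<alpha>\<in>I3tr b c. \<forall>\<beta>\<in>I3tr b c. \<alpha> \<noteq> \<beta> \<longrightarrow>
        rat_adjoin (of_real \<alpha>) \<noteq> rat_adjoin (of_real \<beta>)) \<and>
     (all_cubic_form b c \<longrightarrow> (\<forall>\<alpha>\<in>I3tr b c. totally_real_cubic (of_real \<alpha>))) \<and>
     (\<not> all_cubic_form b c \<longrightarrow>
        (\<exists>\<alpha>\<in>I3tr b c. real_quadratic (of_real \<alpha>) \<and>
           (\<forall>\<beta>\<in>I3tr b c. \<beta> \<noteq> \<alpha> \<longrightarrow> totally_real_cubic (of_real \<beta>))) \<and>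
        (\<exists>n. quadratic_range b c n)) \<and>
     (\<forall>n. quadratic_range b c n \<longrightarrow>
        (\<exists>!\<alpha>. \<alpha> \<in> I3tr b c \<and> real_quadratic (of_real \<alpha>)) \<and>
        (\<forall>\<alpha>\<in>I3tr b c. real_quadratic (of_real \<alpha>) \<longrightarrow>
           poly [: - of_int ((n - b) * (c + n\<^sup>2 - b * n)), of_int c, of_int b, 1 :] \<alpha> = 0 \<and>
           rat_min_poly (of_real \<alpha>) = [: of_int (c + n\<^sup>2 - b * n), of_int n, 1 :]))"
proof (intro conjI ballI impI allI)
  note b = assms(1,2)
  fix \<alpha> \<beta> assume "\<alpha> \<in> I3tr b c" "\<beta> \<in> I3tr b c" "\<alpha> \<noteq> \<beta>"
  then show "rat_adjoin (of_real \<alpha>) \<noteq> rat_adjoin (of_real \<beta>)"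
    using I3tr_adjoin_neq_less[OF b] by (metis linorder_neqE)
next
  note b = assms(1,2)
  fix \<alpha> assume "all_cubic_form b c" "\<alpha> \<in> I3tr b c"
  then show "totally_real_cubic (of_real \<alpha>)"
    using I3tr_totally_real_cubic not_quadratic_range_if_all_cubic_form[OF b] by blast
next
  note b = assms(1,2)
  assume "\<not> all_cubic_form b c"
  then show "\<exists>n. quadratic_range b c n"
    using quadratic_range_exists assms by blast
  then obtain n where n: "quadratic_range b c n" ..
  show "\<exists>\<alpha>\<in>I3tr b c. real_quadratic (of_real \<alpha>) \<and>
      (\<forall>\<beta>\<in>I3tr b c. \<beta> \<noteq> \<alpha> \<longrightarrow> totally_real_cubic (of_real \<beta>))"
    by (rule I3tr_quadratic_element[OF b n]) blast
next
  note b = assms(1,2)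
  fix n assume n: "quadratic_range b c n"
  obtain \<alpha> where \<alpha>: "\<alpha> \<in> I3tr b c" "real_quadratic (of_real \<alpha>)"
    "\<alpha>\<^sup>2 + of_int n * \<alpha> + of_int (c + n\<^sup>2 - b * n) = 0"
    and others: "\<And>\<beta>. \<beta> \<in> I3tr b c \<Longrightarrow> \<beta> \<noteq> \<alpha> \<Longrightarrow> totally_real_cubic (of_real \<beta>)"
    using I3tr_quadratic_element[OF b n] by blast
  \<comment> \<open>Minimal polynomials of degrees 3 and 2 exclude each other.\<close>
  have unique: "\<beta> = \<alpha>" if "\<beta> \<in> I3tr b c" "real_quadratic (of_real \<beta>)" for \<beta>
    using others[OF that(1)] that(2) by (auto simp: real_quadratic_def totally_real_cubic_def)
  with \<alpha> show "\<exists>!\<alpha>. \<alpha> \<in> I3tr b c \<and> real_quadratic (of_real \<alpha>)" by blast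
  fix \<beta> assume "\<beta> \<in> I3tr b c" "real_quadratic (of_real \<beta>)"
  then have "\<beta> = \<alpha>" by (rule unique)
  moreover have "0 < \<alpha>" "\<alpha> < 1" using \<alpha>(1) by (auto simp: I3tr_def)
  ultimately show "rat_min_poly (of_real \<beta>) = [: of_int (c + n\<^sup>2 - b * n), of_int n, 1 :]"
    using \<alpha>(3) rat_min_poly_quadratic(2) by blast
  \<comment> \<open>The cubic splits off the integer root \<open>n - b\<close>.\<close>
  have "poly [: - of_int ((n - b) * (c + n\<^sup>2 - b * n)), of_int c, of_int b, 1 :] \<alpha> =
      (\<alpha> - of_int (n - b)) * (\<alpha>\<^sup>2 + of_int n * \<alpha> + of_int (c + n\<^sup>2 - b * n))"
    by (simp add: algebra_simps power2_eq_square)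
  with \<alpha>(3) \<open>\<beta> = \<alpha>\<close>
  show "poly [: - of_int ((n - b) * (c + n\<^sup>2 - b * n)), of_int c, of_int b, 1 :] \<beta> = 0"
    by simp
qed

end
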